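(* Let $M,N\ge 1$ be integers, let $\beta_{\mathrm d},\beta_{\mathrm{br}},\beta_{\mathrm{ru}},\bar\tau>0$, and let $\mathrm{SNR}$ be the optimal uplink SNR of the RIS-aided link defined in the context, with correlated Rayleigh UE-BS and UE-RIS channels (correlation matrices $\mathbf R_{\mathrm d}$, $\mathbf R_{\mathrm{ru}}$) and a rank-1 LOS RIS-BS channel. Then $$\begin{aligned}\mathrm{Var}\{\mathrm{SNR}\}=\Big(&\beta_{\mathrm d}^2\,\mathrm{tr}\{\mathbf R_{\mathrm d}^2\}+\beta_{\mathrm d}^{3/2}\sqrt{\beta_{\mathrm{br}}\beta_{\mathrm{ru}}}\,N\pi(B-MA)\\&+\beta_{\mathrm d}\beta_{\mathrm{br}}\beta_{\mathrm{ru}}A^2\Big(4(N+F)-\frac{N^2\pi^2}{4}\Big)\\&+MA\sqrt{\beta_{\mathrm d}}\,(\beta_{\mathrm{br}}\beta_{\mathrm{ru}})^{3/2}\big(2\sqrt\pi\,C_1-N(N+F)\pi\big)\\&+(M\beta_{\mathrm{br}}\beta_{\mathrm{ru}})^2\big(C_2-(N+F)^2\big)\Big)\bar\tau^2,\end{aligned}$$ where $A=\lVert\mathbf R_{\mathrm d}^{1/2}\mathbf a_{\mathrm b}\rVert_2$, $B=MA+\dfrac{\mathbf a_{\mathrm b}^H\mathbf R_{\mathrm d}^2\mathbf a_{\mathrm b}}{2A}$, $C_1=\mathbb E\{Y^3\}$, $C_2=\mathbb E\{Y^4\}$ with $Y=\sum_{n=1}^N|\tilde h_{\mathrm{ru},n}|$,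 $\rho_{ij}=(\mathbf R_{\mathrm{ru}})_{ij}$, and $$F=\sum_{i=1}^{N}\sum_{\substack{j=1\\ j\ne i}}^{N}\frac{\pi}{4}\left(1-|\rho_{ij}|^2\right)^2\,{}_2F_1\!\left(\tfrac32,\tfrac32;1;|\rho_{ij}|^2\right),$$ with ${}_2F_1$ the Gaussian hypergeometric function.
   Context: Channel model. $\mathbf R_{\mathrm d}\in\mathbb C^{M\times M}$ and $\mathbf R_{\mathrm{ru}}\in\mathbb C^{N\times N}$ are correlation matrices (Hermitian positive semidefinite with unit diagonal), and $\mathbf R^{1/2}$ denotes the Hermitian positive semidefinite square root. $\mathbf u_{\mathrm d}\sim\mathcal{CN}(\mathbf 0,\mathbf I_M)$ and $\mathbf u_{\mathrm{ru}}\sim\mathcal{CN}(\mathbf 0,\mathbf I_N)$ are independent standard circularly symmetric complex Gaussian vectors (each entry has $\mathbb E|u|^2=1$). The UE-BS channel is $\mathbf h_{\mathrm d}=\sqrt{\beta_{\mathrm d}}\,\mathbf R_{\mathrm d}^{1/2}\mathbf u_{\mathrm d}$; the UE-RIS channel is $\mathbf h_{\mathrm{ru}}=\sqrt{\beta_{\mathrm{ru}}}\,\tilde{\mathbf h}_{\mathrm{ru}}$ with $\tilde{\mathbf h}_{\mathrm{ru}}=\mathbf R_{\mathrm{ru}}^{1/2}\mathbf u_{\mathrm{ru}}$. The RIS-BS channel is $\mathbf H_{\mathrm{br}}=\sqrt{\beta_{\mathrm{br}}}\,\mathbf a_{\mathrm b}\mathbf a_{\mathrm r}^H$, where the steering vectors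 $\mathbf a_{\mathrm b}\in\mathbb C^M$, $\mathbf a_{\mathrm r}\in\mathbb C^N$ are deterministic with all entries of modulus 1 (so $\lVert\mathbf a_{\mathrm b}\rVert_2^2=M$). It is assumed that $\mathbf R_{\mathrm d}^{1/2}\mathbf a_{\mathrm b}\neq\mathbf 0$, so that $\mathbf a_{\mathrm b}^H\mathbf h_{\mathrm d}\ne0$ almost surely. Optimal SNR. The global uplink channel is $\mathbf h=\mathbf h_{\mathrm d}+\mathbf H_{\mathrm{br}}\boldsymbol\Phi\mathbf h_{\mathrm{ru}}$ with the SNR-maximising RIS phase matrix $$\boldsymbol\Phi=\psi\,\mathrm{diag}\{e^{j\angle\mathbf a_{\mathrm r}}\}\,\mathrm{diag}\{e^{-j\angle\mathbf h_{\mathrm{ru}}}\},\qquad \psi=\frac{\mathbf a_{\mathrm b}^H\mathbf h_{\mathrm d}}{|\mathbf a_{\mathrm b}^H\mathbf h_{\mathrm d}|},$$ where angles and exponentials of vectors are taken entrywise. Hence $\mathbf h=\mathbf h_{\mathrm d}+\alpha\,\mathbf a_{\mathrm b}$ with $\alpha=\sqrt{\beta_{\mathrm{br}}\beta_{\mathrm{ru}}}\,\psi\,Y$ and $Y=\sum_{n=1}^N|\tilde h_{\mathrm{ru},n}|$, and the optimal uplink SNR is $$\mathrm{SNR}=\mathbf h^H\mathbf h\,\bar\tau=(\mathbf h_{\mathrm d}^H+\alpha^*\mathbf a_{\mathrm b}^H)(\mathbf h_{\mathrm d}+\alpha\,\mathbf a_{\mathrm b})\,\bar\tau.$$ Convention: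 when $|\rho_{ij}|=1$, the expression $(1-x)^2{}_2F_1(\frac32,\frac32;1;x)$ at $x=1$ is understood as its limit as $x\to1^-$. *)

theory Defs
  imports "HOL-Analysis.Analysis" "HOL-Probability.Probability"
begin

subsection \<open>Complex vectors and matrices\<close>

definition cdot :: "complex ^ 'k \<Rightarrow> complex ^ 'k \<Rightarrow> complex" where
  "cdot x y = (\<Sum>i\<in>UNIV. cnj (x $ i) * y $ i)"

definition hermitian :: "complex ^ 'k ^ 'k \<Rightarrow> bool" where
  "hermitian S \<longleftrightarrow> (\<forall>i j. S $ i $ j = cnj (S $ j $ i))"

definition psd :: "complex ^ 'k ^ 'k \<Rightarrow> bool" where
  "psd S \<longleftrightarrow> hermitian S \<and> (\<forall>x. 0 \<le> Re (cdot x (S *v x)))"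

definition correlation_matrix :: "complex ^ 'k ^ 'k \<Rightarrow> bool" where
  "correlation_matrix R \<longleftrightarrow> psd R \<and> (\<forall>i. R $ i $ i = 1)"

text \<open>Meaningful only for positive semidefinite \<open>R\<close>, where the root exists and is unique.\<close>

definition mat_sqrt :: "complex ^ 'k ^ 'k \<Rightarrow> complex ^ 'k ^ 'k" where
  "mat_sqrt R = (THE S. psd S \<and> S ** S = R)"

definition diag_mat :: "complex ^ 'k \<Rightarrow> complex ^ 'k ^ 'k" where
  "diag_mat d = (\<chi> i j. if i = j then d $ i else 0)"

subsection \<open>Standard complex Gaussian vectors\<close>

text \<open>Real and imaginary parts each have variance 1/2, so that \<open>E |z|\<^sup>2 = 1\<close>; the second
  parameter of the library's normal density is the standard deviation.\<close>

definition std_complex_normal :: "'a measure \<Rightarrow> ('a \<Rightarrow> complex) \<Rightarrow> bool" where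
  "std_complex_normal P z \<longleftrightarrow>
     distributed P lborel (\<lambda>\<omega>. Re (z \<omega>)) (normal_density 0 (sqrt (1/2))) \<and>
     distributed P lborel (\<lambda>\<omega>. Im (z \<omega>)) (normal_density 0 (sqrt (1/2))) \<and>
     prob_space.indep_var P borel (\<lambda>\<omega>. Re (z \<omega>)) borel (\<lambda>\<omega>. Im (z \<omega>))"

definition std_complex_normal_vec :: "'a measure \<Rightarrow> ('a \<Rightarrow> complex ^ 'k) \<Rightarrow> bool" where
  "std_complex_normal_vec P u \<longleftrightarrow>
     (\<forall>i. std_complex_normal P (\<lambda>\<omega>. u \<omega> $ i)) \<and>
     prob_space.indep_vars P (\<lambda>_. borel) (\<lambda>i \<omega>. u \<omega> $ i) UNIV"

text \<open>The library's notion of independence of two random variables forces them to have the same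
  codomain type; this is its unfolding for random variables of different types, which requires
  their generated sigma-algebras to be independent.\<close>

definition indep_rvs :: "'a measure \<Rightarrow> ('a \<Rightarrow> 'b::topological_space) \<Rightarrow> ('a \<Rightarrow> 'c::topological_space) \<Rightarrow> bool" where
  "indep_rvs P X Z \<longleftrightarrow> X \<in> borel_measurable P \<and> Z \<in> borel_measurable P \<and>
     prob_space.indep_set P
       (sets (vimage_algebra (space P) X borel)) (sets (vimage_algebra (space P) Z borel))"

subsection \<open>The RIS-aided uplink\<close>

definition rayleigh_channel :: "real \<Rightarrow> complex ^ 'k ^ 'k \<Rightarrow> complex ^ 'k \<Rightarrow> complex ^ 'k" where
  "rayleigh_channel \<beta> R u = sqrt \<beta> *\<^sub>R (mat_sqrt R *v u)"

definition los_channel :: "real \<Rightarrow> complex ^ 'm \<Rightarrow> complex ^ 'n \<Rightarrow> complex ^ 'n ^ 'm" where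
  "los_channel \<beta> ab ar = (\<chi> i j. complex_of_real (sqrt \<beta>) * (ab $ i * cnj (ar $ j)))"

text \<open>Where \<open>cdot ab h_d = 0\<close> (a null event) the phase \<open>\<psi>\<close> is \<open>0 / 0 = 0\<close>.\<close>

definition opt_phase_matrix ::
  "complex ^ 'm \<Rightarrow> complex ^ 'n \<Rightarrow> complex ^ 'm \<Rightarrow> complex ^ 'n \<Rightarrow> complex ^ 'n ^ 'n" where
  "opt_phase_matrix ab ar h_d h_ru =
     (let \<psi> = cdot ab h_d / complex_of_real (cmod (cdot ab h_d))
      in mat \<psi> ** diag_mat (\<chi> i. cis (Arg (ar $ i))) ** diag_mat (\<chi> i. cis (- Arg (h_ru $ i))))"

definition opt_channel ::
  "real \<Rightarrow> complex ^ 'm \<Rightarrow> complex ^ 'n \<Rightarrow> complex ^ 'm \<Rightarrow> complex ^ 'n \<Rightarrow> complex ^ 'm" where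
  "opt_channel \<beta>br ab ar h_d h_ru =
     h_d + (los_channel \<beta>br ab ar ** opt_phase_matrix ab ar h_d h_ru) *v h_ru"

definition opt_SNR ::
  "real \<Rightarrow> real \<Rightarrow> complex ^ 'm \<Rightarrow> complex ^ 'n \<Rightarrow> complex ^ 'm \<Rightarrow> complex ^ 'n \<Rightarrow> real" where
  "opt_SNR \<tau> \<beta>br ab ar h_d h_ru =
     (let h = opt_channel \<beta>br ab ar h_d h_ru in Re (cdot h h) * \<tau>)"

subsection \<open>The hypergeometric term\<close>

definition hyp2F1 :: "real \<Rightarrow> real \<Rightarrow> real \<Rightarrow> real \<Rightarrow> real" where
  "hyp2F1 a b c x = eval_fps (fps_hypergeo [a, b] [c] 1) x"

text \<open>\<open>(1 - x)\<^sup>2 \<cdot> 2F1(3/2, 3/2; 1; x)\<close>, taken at \<open>x = 1\<close>, where the series diverges, as its limit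
  from the left.\<close>

definition hyp_term :: "real \<Rightarrow> real" where
  "hyp_term x =
     (let f = (\<lambda>y. (1 - y)\<^sup>2 * hyp2F1 (3/2) (3/2) 1 y)
      in if x = 1 then Lim (at_left 1) f else f x)"

definition corr_F :: "complex ^ 'n ^ 'n \<Rightarrow> real" where
  "corr_F R = (\<Sum>i\<in>UNIV. \<Sum>j\<in>UNIV - {i}. pi / 4 * hyp_term ((cmod (R $ i $ j))\<^sup>2))"

end

(* For almost every channel, SNR / tau = beta_d G + 2 sqrt (beta_d beta_br beta_ru) V Y + M beta_br beta_ru Y^2,
   where S is the root of R_d, G = |S u_d|^2, V = |(S a_b)^H u_d|, and Y is independent of (G, V). The
   variance therefore only needs mixed moments of moduli of two linear functionals z, w of a standard
   complex Gaussian vector. All of these follow from the joint Laplace transform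
     E exp (-s |z|^2 - t |w|^2) = 1 / ((1 + s E|z|^2) (1 + t E|w|^2) - s t |E z* w|^2):
   even powers by letting s, t tend to 0, first powers through
     2 sqrt pi y = integral over R of (1 - exp (-s^2 y^2)) / s^2.
   For E |z| |w| the geometric expansion of the transform in |E z* w|^2 turns the double integral into
   pi/4 2F1(-1/2, -1/2; 1; |E z* w|^2), which Euler's transformation brings into the stated form. *)
theory Submission
  imports Defs "HOL-Real_Asymp.Real_Asymp"
begin

text \<open>Why a transform and not densities: two coordinates of a correlated channel may be
  linearly dependent (|rho_ij| = 1), so that they have no joint density. The transform keeps the
  same form in that case, and Cauchy-Schwarz keeps its denominator positive. The moments are mostly
  computed as integrals of nonnegative functions in \<open>ennreal\<close>. Swapping integrals and
  sums then needs no dominating function, monotone limits suffice, and a finite value gives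
  integrability along with the moment. Euler's transformation is not cosmetic: the series of the
  statement diverges at 1, while that of 2F1(-1/2, -1/2; 1; x) converges there, so the limit
  convention becomes continuity of a power series on the closed unit interval. The unit diagonal of
  a correlation matrix makes every coordinate of \<open>mat_sqrt R *v u\<close> a functional with a
  unit coefficient vector, so first powers are computed for unit vectors and other vectors are
  rescaled. \<open>mat_sqrt\<close> is a definite description and has no properties until existence
  and uniqueness of the root are proved; a real spectral theorem supplies both. The third and fourth
  moments of \<open>Y\<close> stay symbolic and require only integrability.\<close>

subsection \<open>Positive semidefinite square roots\<close>

text \<open>Along the line x + t f x the quadratic form has no constant term and linear coefficient
  2 |f x|^2. If f x were nonzero, a small negative t would make the form negative. Invariance of
  \<open>W\<close> keeps this line inside the subspace where the form is nonnegative.\<close>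

lemma self_adjoint_psd_kernel:
  fixes f :: "'a::real_inner \<Rightarrow> 'a"
  assumes "linear f" and sa: "\<And>x y. x \<bullet> f y = f x \<bullet> y" and W: "subspace W" "f ` W \<subseteq> W"
    and psd: "\<And>y. y \<in> W \<Longrightarrow> 0 \<le> y \<bullet> f y" and x: "x \<in> W" "x \<bullet> f x = 0"
  shows "f x = 0"
proof -
  interpret linear f by fact
  define y where "y = f x"
  have y: "y \<in> W" using W x unfolding y_def by auto
  have quad: "0 \<le> 2 * t * (y \<bullet> y) + t\<^sup>2 * (y \<bullet> f y)" for t
  proof -
    have "0 \<le> (x + t *\<^sub>R y) \<bullet> f (x + t *\<^sub>R y)"
      using W x y by (intro psd subspace_add subspace_mul) auto
    also have "\<dots> = 2 * t * (y \<bullet> y) + t\<^sup>2 * (y \<bullet> f y)"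
      using x(2) sa[of y x] sa[of x y]
      by (simp add: add scale inner_add_left inner_add_right power2_eq_square y_def inner_commute)
    finally show ?thesis .
  qed
  have "y \<bullet> y = 0"
  proof (rule ccontr)
    assume "y \<bullet> y \<noteq> 0"
    then have pos: "0 < y \<bullet> y" by (simp add: order_less_le)
    define c where "c = y \<bullet> f y"
    have c: "0 \<le> c" using psd[OF y] by (simp add: c_def)
    \<comment> \<open>Negative, and small enough that \<open>t * c\<close> stays above
      \<open>- (y \<bullet> y)\<close>; the summand 1 keeps the denominator positive when
      \<open>c\<close> is 0.\<close>
    define t where "t = - (y \<bullet> y) / (c + 1)"
    have "t < 0" using pos c by (simp add: t_def divide_neg_pos)
    have "2 * t * (y \<bullet> y) + t\<^sup>2 * c = t * (2 * (y \<bullet> y) + t * c)"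
      by (simp add: algebra_simps power2_eq_square)
    moreover have "2 * (y \<bullet> y) + t * c > 0"
    proof -
      have "(y \<bullet> y) * c / (c + 1) \<le> y \<bullet> y"
        using c pos by (simp add: field_simps)
      then have "(y \<bullet> y) * c / (c + 1) < 2 * (y \<bullet> y)" using pos by linarith
      then show ?thesis by (simp add: t_def)
    qed
    ultimately show False using quad[of t] \<open>t < 0\<close>
      by (metis c_def mult_neg_pos not_le)
  qed
  then show ?thesis by (simp add: y_def)
qed

text \<open>The maximiser of the quadratic form on the unit sphere of \<open>W\<close> is an
  eigenvector. Lagrange multipliers are avoided: with \<open>l\<close> the maximum, l id - f is
  nonnegative on \<open>W\<close> and its form vanishes at the maximiser, so
  \<open>self_adjoint_psd_kernel\<close> applies.\<close>

lemma self_adjoint_eigenvector: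
  fixes f :: "'a::euclidean_space \<Rightarrow> 'a"
  assumes f: "linear f" and sa: "\<And>x y. x \<bullet> f y = f x \<bullet> y" and W: "subspace W" "f ` W \<subseteq> W" "W \<noteq> {0}"
  obtains x where "x \<in> W" "norm x = 1" "f x = (x \<bullet> f x) *\<^sub>R x"
proof -
  interpret linear f by fact
  obtain w where w: "w \<in> W" "w \<noteq> 0" using W subspace_0 by fastforce
  have "compact (sphere 0 1 \<inter> W)" by (simp add: closed_subspace W compact_Int_closed)
  moreover have "(1 / norm w) *\<^sub>R w \<in> sphere 0 1 \<inter> W"
    using w W by (simp add: subspace_scale)
  moreover have "continuous_on (sphere 0 1 \<inter> W) (\<lambda>x. x \<bullet> f x)"
    by (intro continuous_intros linear_continuous_on linear_conv_bounded_linear[THEN iffD1] f)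
  ultimately obtain x where x: "x \<in> W" "norm x = 1"
    and sup: "\<And>y. y \<in> W \<Longrightarrow> norm y = 1 \<Longrightarrow> y \<bullet> f y \<le> x \<bullet> f x"
    using continuous_attains_sup[of "sphere 0 1 \<inter> W" "\<lambda>x. x \<bullet> f x"]
    by (metis (no_types, lifting) Int_iff dist_0_norm empty_iff mem_sphere)
  define l where "l = x \<bullet> f x"
  define g where "g y = l *\<^sub>R y - f y" for y
  have "g x = 0"
  proof (rule self_adjoint_psd_kernel[where W = W and f = g and x = x])
    show "linear g" unfolding g_def[abs_def] by (intro linear_compose_sub f linear_scale_self)
    show "y \<bullet> g z = g y \<bullet> z" for y z by (simp add: g_def inner_diff_left inner_diff_right sa)
    show "g ` W \<subseteq> W" using W by (auto simp: g_def intro!: subspace_diff subspace_mul)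
    show "x \<bullet> g x = 0" using x by (simp add: g_def inner_diff_right l_def dot_square_norm)
    show "0 \<le> y \<bullet> g y" if y: "y \<in> W" for y
    proof (cases "y = 0")
      case False
      define z where "z = (1 / norm y) *\<^sub>R y"
      have "z \<bullet> f z \<le> l" unfolding l_def
        by (rule sup) (use False y W in \<open>auto simp: z_def intro: subspace_mul\<close>)
      then have "y \<bullet> f y \<le> l * (norm y)\<^sup>2"
        using False by (simp add: z_def scale field_simps power2_eq_square)
      then show ?thesis by (simp add: g_def inner_diff_right dot_square_norm)
    qed simp
  qed (use W x in auto)
  then show thesis using that x by (simp add: g_def l_def)
qed

definition orthonormal :: "'a::real_inner set \<Rightarrow> bool" where
  "orthonormal B \<longleftrightarrow> (\<forall>b\<in>B. \<forall>c\<in>B. b \<bullet> c = (if b = c then 1 else 0))"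

lemma orthonormal_finite_card:
  fixes B :: "'a::euclidean_space set"
  assumes "orthonormal B"
  shows "finite B" "card B \<le> DIM('a)"
proof -
  have "0 \<notin> B" using assms unfolding orthonormal_def by (metis inner_zero_left zero_neq_one)
  then have "independent B"
    using assms by (intro pairwise_orthogonal_independent)
      (auto simp: pairwise_def orthogonal_def orthonormal_def)
  then show "finite B" "card B \<le> DIM('a)"
    using independent_bound by auto
qed

text \<open>An orthonormal set of eigenvectors of maximal cardinality replaces an induction on the
  dimension. Its orthogonal complement is invariant, and an eigenvector found there would enlarge
  the set; so the complement is trivial and contains the remainder of every expansion.\<close>

lemma self_adjoint_eigenbasis:
  fixes f :: "'a::euclidean_space \<Rightarrow> 'a"
  assumes f: "linear f" and sa: "\<And>x y. x \<bullet> f y = f x \<bullet> y"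
  obtains B where "finite B" "orthonormal B" "\<And>b. b \<in> B \<Longrightarrow> f b = (b \<bullet> f b) *\<^sub>R b"
    "\<And>x. (\<Sum>b\<in>B. (x \<bullet> b) *\<^sub>R b) = x"
proof -
  define \<E> where "\<E> = {B. orthonormal B \<and> (\<forall>b\<in>B. f b = (b \<bullet> f b) *\<^sub>R b)}"
  have "{} \<in> \<E>" by (auto simp: \<E>_def orthonormal_def)
  moreover have "\<forall>B. B \<in> \<E> \<longrightarrow> card B < DIM('a) + 1"
    using orthonormal_finite_card by (auto simp: \<E>_def less_Suc_eq_le)
  ultimately obtain B where B: "B \<in> \<E>" and max: "\<And>C. C \<in> \<E> \<Longrightarrow> card C \<le> card B"
    using ex_has_greatest_nat[of "\<lambda>B. B \<in> \<E>" "{}" card "DIM('a) + 1"] by blast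
  have on: "orthonormal B" and eig: "\<And>b. b \<in> B \<Longrightarrow> f b = (b \<bullet> f b) *\<^sub>R b"
    using B by (auto simp: \<E>_def)
  have fin: "finite B" using on orthonormal_finite_card by blast
  define W where "W = {x. \<forall>b\<in>B. b \<bullet> x = 0}"
  have W: "subspace W" by (auto simp: W_def subspace_def inner_add_right)
  have "f ` W \<subseteq> W"
  proof (clarsimp simp: W_def)
    fix x b assume x: "\<forall>b\<in>B. b \<bullet> x = 0" and b: "b \<in> B"
    have "b \<bullet> f x = f b \<bullet> x" by (rule sa)
    also have "\<dots> = (b \<bullet> f b) * (b \<bullet> x)" by (subst eig[OF b]) simp
    finally show "b \<bullet> f x = 0" using x b by simp
  qed
  have "W = {0}"
  proof (rule ccontr)
    assume "W \<noteq> {0}"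
    then obtain x where x: "x \<in> W" "norm x = 1" "f x = (x \<bullet> f x) *\<^sub>R x"
      using self_adjoint_eigenvector[OF f sa W \<open>f ` W \<subseteq> W\<close>] by blast
    have "x \<bullet> x = 1" using x by (simp add: dot_square_norm)
    then have "insert x B \<in> \<E>" using x on eig
      by (auto simp: \<E>_def orthonormal_def W_def inner_commute)
    moreover have "x \<notin> B" using x \<open>x \<bullet> x = 1\<close> by (auto simp: W_def)
    ultimately show False using max[of "insert x B"] fin by simp
  qed
  have "(\<Sum>b\<in>B. (x \<bullet> b) *\<^sub>R b) = x" for x
  proof -
    have "b \<bullet> (\<Sum>c\<in>B. (x \<bullet> c) *\<^sub>R c) = x \<bullet> b" if "b \<in> B" for b
    proof -
      have "b \<bullet> (\<Sum>c\<in>B. (x \<bullet> c) *\<^sub>R c) = (\<Sum>c\<in>B. if b = c then x \<bullet> c else 0)"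
        using on that unfolding orthonormal_def inner_sum_right
        by (intro sum.cong) auto
      then show ?thesis using fin that by simp
    qed
    then have "x - (\<Sum>b\<in>B. (x \<bullet> b) *\<^sub>R b) \<in> W"
      by (simp add: W_def inner_diff_right inner_commute)
    then show ?thesis using \<open>W = {0}\<close> by auto
  qed
  then show thesis using that fin on eig by blast
qed

lemma psd_root_exists:
  fixes f :: "'a::euclidean_space \<Rightarrow> 'a"
  assumes f: "linear f" and sa: "\<And>x y. x \<bullet> f y = f x \<bullet> y" and psd: "\<And>x. 0 \<le> x \<bullet> f x"
  obtains g where "linear g" "\<And>x y. x \<bullet> g y = g x \<bullet> y" "\<And>x. 0 \<le> x \<bullet> g x" "\<And>x. g (g x) = f x"
proof -
  obtain B where fin: "finite B" and on: "orthonormal B"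
    and eig: "\<And>b. b \<in> B \<Longrightarrow> f b = (b \<bullet> f b) *\<^sub>R b"
    and dec: "\<And>x. (\<Sum>b\<in>B. (x \<bullet> b) *\<^sub>R b) = x"
    using self_adjoint_eigenbasis[OF f sa] by metis
  interpret f: linear f by fact
  define g where "g x = (\<Sum>b\<in>B. (sqrt (b \<bullet> f b) * (x \<bullet> b)) *\<^sub>R b)" for x
  have gb: "g x \<bullet> b = sqrt (b \<bullet> f b) * (x \<bullet> b)" if "b \<in> B" for x b
  proof -
    have "g x \<bullet> b = (\<Sum>c\<in>B. if b = c then sqrt (c \<bullet> f c) * (x \<bullet> c) else 0)"
      using on that unfolding orthonormal_def g_def inner_sum_left
      by (intro sum.cong) auto
    then show ?thesis using fin that by simp
  qed
  show thesis
  proof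
    show "linear g"
      by (rule linearI) (simp_all add: g_def inner_add_left distrib_left scaleR_add_left
          sum.distrib scaleR_sum_right mult.left_commute)
    show "x \<bullet> g y = g x \<bullet> y" for x y
      by (simp add: g_def inner_sum_left inner_sum_right mult_ac inner_commute)
    show "0 \<le> x \<bullet> g x" for x
      unfolding g_def inner_sum_right
      by (rule sum_nonneg) (simp add: psd inner_commute mult.assoc)
    show "g (g x) = f x" for x
    proof -
      have "f x = (\<Sum>b\<in>B. (x \<bullet> b) *\<^sub>R f b)"
        by (subst dec[of x, symmetric]) (simp add: f.sum f.scale)
      also have "\<dots> = (\<Sum>b\<in>B. ((b \<bullet> f b) * (x \<bullet> b)) *\<^sub>R b)"
        by (rule sum.cong[OF refl], subst eig) (simp_all add: mult.commute)
      also have "\<dots> = g (g x)"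
        unfolding g_def[of "g x"]
        by (rule sum.cong) (simp_all add: gb psd flip: mult.assoc)
      finally show ?thesis by simp
    qed
  qed
qed

text \<open>The difference d = f - g is self-adjoint, so it suffices to refute a nonzero eigenvalue.
  On such an eigenvector both quadratic forms must vanish, and then f and g themselves do.\<close>

lemma psd_root_unique:
  fixes f g :: "'a::euclidean_space \<Rightarrow> 'a"
  assumes f: "linear f" "\<And>x y. x \<bullet> f y = f x \<bullet> y" "\<And>x. 0 \<le> x \<bullet> f x"
    and g: "linear g" "\<And>x y. x \<bullet> g y = g x \<bullet> y" "\<And>x. 0 \<le> x \<bullet> g x"
    and eq: "\<And>x. f (f x) = g (g x)"
  shows "f = g"
proof -
  define d where "d x = f x - g x" for x
  have d: "linear d" unfolding d_def[abs_def] by (intro linear_compose_sub f g)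
  have dsa: "x \<bullet> d y = d x \<bullet> y" for x y
    by (simp add: d_def inner_diff_left inner_diff_right f(2) g(2))
  interpret f: linear f by fact
  interpret g: linear g by fact
  interpret d: linear d by fact
  obtain B where "finite B" "orthonormal B" and eig: "\<And>b. b \<in> B \<Longrightarrow> d b = (b \<bullet> d b) *\<^sub>R b"
    and dec: "\<And>x. (\<Sum>b\<in>B. (x \<bullet> b) *\<^sub>R b) = x"
    using self_adjoint_eigenbasis[OF d dsa] by metis
  have "d b = 0" if b: "b \<in> B" for b
  proof (rule ccontr)
    assume nz: "d b \<noteq> 0"
    define l where "l = b \<bullet> d b"
    have db: "d b = l *\<^sub>R b" unfolding l_def by (rule eig[OF b])
    have l: "l \<noteq> 0" using nz db by auto
    \<comment> \<open>The factorisation f^2 - g^2 = f (f - g) + (f - g) g, which respects the order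
      of f and g and so holds without their commuting.\<close>
    have "f (d b) + d (g b) = 0"
      by (simp add: d_def f.diff eq)
    then have "0 = b \<bullet> f (d b) + b \<bullet> d (g b)" by (metis inner_add_right inner_zero_right)
    also have "\<dots> = l * (b \<bullet> f b + b \<bullet> g b)"
      unfolding dsa[of b "g b"] db by (simp add: f.scale distrib_left)
    finally have "b \<bullet> f b = 0" "b \<bullet> g b = 0"
      using l f(3)[of b] g(3)[of b] by (auto simp: add_nonneg_eq_0_iff)
    then have "f b = 0" "g b = 0"
      using self_adjoint_psd_kernel[of f UNIV b] self_adjoint_psd_kernel[of g UNIV b] f g by auto
    then show False using nz by (simp add: d_def)
  qed
  then have "d x = 0" for x
    by (subst dec[of x, symmetric]) (simp add: d.sum d.scale)
  then show ?thesis by (auto simp: d_def)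
qed

section \<open>From real self-adjoint maps to complex Hermitian matrices\<close>

lemma inner_eq_Re_cdot: "x \<bullet> y = Re (cdot x y)"
  by (simp add: inner_vec_def cdot_def inner_complex_def)

lemma cdot_matrix_vector: "cdot x (A *v y) = (\<Sum>i\<in>UNIV. \<Sum>j\<in>UNIV. cnj (x $ i) * A $ i $ j * y $ j)"
  by (simp add: cdot_def matrix_vector_mult_def sum_distrib_left mult.assoc)

lemma cdot_hermitian:
  assumes "hermitian S"
  shows "cdot x (S *v y) = cdot (S *v x) y"
proof -
  have "cdot x (S *v y) = (\<Sum>j\<in>UNIV. \<Sum>i\<in>UNIV. cnj (x $ i) * S $ i $ j * y $ j)"
    unfolding cdot_matrix_vector by (rule sum.swap)
  also have "\<dots> = (\<Sum>j\<in>UNIV. \<Sum>i\<in>UNIV. cnj (S $ j $ i * x $ i) * y $ j)"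
    using assms by (intro sum.cong refl) (metis complex_cnj_mult hermitian_def mult.commute)
  also have "\<dots> = cdot (S *v x) y"
    by (simp add: cdot_def matrix_vector_mult_def sum_distrib_right)
  finally show ?thesis .
qed

lemma cdot_scale_right: "cdot x (c *s y) = c * cdot x y"
  by (simp add: cdot_def vector_scalar_mult_def sum_distrib_left mult_ac)

lemma cdot_scale_left: "cdot (c *s x) y = cnj c * cdot x y"
  by (simp add: cdot_def vector_scalar_mult_def sum_distrib_left mult_ac)

lemma scaleR_eq_vector_scalar_mult: "r *\<^sub>R (x :: complex ^ 'k) = complex_of_real r *s x"
  by (simp add: vec_eq_iff complex_eq_iff)

lemma matrix_linear: "linear ((*v) (A :: complex ^ 'n ^ 'm))"
  by (rule linearI)
    (simp_all add: matrix_vector_right_distrib scaleR_eq_vector_scalar_mult vector_scalar_commute)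

lemma psd_imp_real_psd:
  assumes "psd S"
  shows "linear ((*v) S)" "x \<bullet> (S *v y) = (S *v x) \<bullet> y" "0 \<le> x \<bullet> (S *v x)"
  using assms by (auto simp: psd_def inner_eq_Re_cdot cdot_hermitian matrix_linear)

text \<open>The spectral argument takes place in the underlying real space, so the root
  \<open>g\<close> is at first only real linear; commuting with the complex structure
  \<open>J\<close> makes it a complex matrix. Its Hermitian symmetry needs the imaginary part of
  \<open>cdot\<close> as well, which is the real inner product taken against
  \<open>J x\<close>.\<close>

lemma mat_sqrt_psd:
  fixes R :: "complex ^ 'k ^ 'k"
  assumes R: "psd R"
  shows "psd (mat_sqrt R)" "mat_sqrt R ** mat_sqrt R = R"
proof -
  obtain g where g: "linear g" "\<And>x y. x \<bullet> g y = g x \<bullet> y" "\<And>x. 0 \<le> x \<bullet> g x" "\<And>x. g (g x) = R *v x"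
    using psd_root_exists[OF psd_imp_real_psd[OF R]] by metis
  interpret g: linear g by fact
  define J :: "complex ^ 'k \<Rightarrow> complex ^ 'k" where "J x = \<i> *s x" for x
  have J: "linear J" unfolding J_def
    by (rule linearI)
      (simp_all add: scaleR_eq_vector_scalar_mult mult.commute)
  have JJ: "J (J x) = - x" for x by (simp add: J_def vec_eq_iff)
  have Jsa: "x \<bullet> J y = - (J x \<bullet> y)" for x y
    by (simp add: inner_eq_Re_cdot J_def cdot_scale_left cdot_scale_right)
  have RJ: "R *v J x = J (R *v x)" for x by (simp add: J_def vector_scalar_commute)
  interpret J: linear J by fact
  \<comment> \<open>The root is complex linear because \<open>- J g J\<close> is a root as well.\<close>
  have "g = (\<lambda>x. - J (g (J x)))"
  proof (rule psd_root_unique[OF g(1-3)])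
    show "linear (\<lambda>x. - J (g (J x)))"
      using linear_compose[OF linear_compose[OF J g(1)] J] by (simp add: o_def linear_compose_neg)
    show "x \<bullet> - J (g (J y)) = - J (g (J x)) \<bullet> y" for x y
      by (simp add: Jsa g(2))
    show "0 \<le> x \<bullet> - J (g (J x))" for x
      by (simp add: Jsa g(3))
    show "g (g x) = - J (g (J (- J (g (J x)))))" for x
      by (simp add: JJ J.neg g.neg g(4) RJ)
  qed
  then have gJ: "g (J x) = J (g x)" for x
    by (metis JJ add.inverse_inverse)
  have gc: "g (c *s x) = c *s g x" for c x
  proof -
    have "c *s x = Re c *\<^sub>R x + Im c *\<^sub>R J x" for x :: "complex ^ 'k"
      by (simp add: vec_eq_iff J_def complex_eq_iff)
    then show ?thesis by (simp add: g.add g.scale gJ)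
  qed
  define S where "S = matrix g"
  have Sv: "S *v x = g x" for x
    unfolding S_def
    by (rule matrix_works) (simp add: Vector_Spaces.linear_iff vec.vector_space_axioms g.add gc)
  have "hermitian S"
    unfolding hermitian_def
  proof (intro allI)
    have c: "cdot x (g y) = cdot (g x) y" for x y
    proof -
      have "Re (cdot x (g y)) = Re (cdot (g x) y)" using g(2) by (simp add: inner_eq_Re_cdot)
      moreover have "Im (cdot x (g y)) = Im (cdot (g x) y)"
        using g(2)[of "J x" y] by (simp add: inner_eq_Re_cdot gJ) (simp add: J_def cdot_scale_left)
      ultimately show ?thesis by (simp add: complex_eq_iff)
    qed
    have comp: "cdot (axis i 1) x = x $ i" "cdot x (axis i 1) = cnj (x $ i)" for i and x :: "complex ^ 'k"
      by (simp_all add: cdot_def axis_def if_distrib if_distribR cong: if_cong)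
    have axcol: "(S *v axis j 1) $ i = S $ i $ j" for i j
      by (simp add: matrix_vector_mult_def axis_def if_distrib cong: if_cong)
    fix i j
    have "S $ i $ j = cdot (axis i 1) (S *v axis j 1)"
      by (simp add: comp axcol)
    also have "\<dots> = cdot (S *v axis i 1) (axis j 1)" by (simp add: Sv c)
    also have "\<dots> = cnj (S $ j $ i)"
      by (simp add: comp axcol)
    finally show "S $ i $ j = cnj (S $ j $ i)" .
  qed
  then have "psd S" using g(3) by (simp add: psd_def Sv inner_eq_Re_cdot)
  moreover have "S ** S = R"
    by (simp add: matrix_eq Sv g(4) flip: matrix_vector_mul_assoc)
  moreover have "T = S" if "psd T" "T ** T = R" for T
  proof -
    have "(*v) T = (*v) S"
      using psd_imp_real_psd[OF that(1)] psd_imp_real_psd[OF \<open>psd S\<close>] that(2) \<open>S ** S = R\<close>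
      by (intro psd_root_unique) (auto simp: matrix_vector_mul_assoc)
    then show ?thesis by (auto simp: matrix_eq fun_eq_iff)
  qed
  ultimately have "\<exists>!S. psd S \<and> S ** S = R" by metis
  from theI'[OF this] show "psd (mat_sqrt R)" "mat_sqrt R ** mat_sqrt R = R"
    by (simp_all add: mat_sqrt_def)
qed

subsection \<open>Integrals over the real line\<close>

lemma nn_integral_exp_neg_square:
  fixes a :: real
  assumes "0 < a"
  shows "(\<integral>\<^sup>+s. ennreal (exp (- (s * a)\<^sup>2)) \<partial>lborel) = ennreal (sqrt pi / a)"
proof -
  define \<sigma> where "\<sigma> = 1 / (a * sqrt 2)"
  have \<sigma>: "\<sigma> > 0" "2 * \<sigma>\<^sup>2 = 1 / a\<^sup>2"
    using assms by (auto simp: \<sigma>_def power_mult_distrib power_divide)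
  have *: "exp (- (s * a)\<^sup>2) = sqrt pi / a * normal_density 0 \<sigma> s" for s
  proof -
    have "sqrt (2 * pi * \<sigma>\<^sup>2) = sqrt pi / a"
    proof -
      have "2 * pi * \<sigma>\<^sup>2 = pi / a\<^sup>2" using \<sigma>(2) by (metis mult.commute mult.left_commute times_divide_eq_right mult.right_neutral)
      then show ?thesis using assms by (simp add: real_sqrt_divide)
    qed
    then show ?thesis
      using assms by (simp add: normal_density_def \<sigma> power_mult_distrib)
  qed
  have "(\<integral>\<^sup>+s. ennreal (exp (- (s * a)\<^sup>2)) \<partial>lborel)
      = (\<integral>\<^sup>+s. ennreal (sqrt pi / a) * ennreal (normal_density 0 \<sigma> s) \<partial>lborel)"
    using assms by (intro nn_integral_cong) (simp add: * flip: ennreal_mult)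
  also have "\<dots> = ennreal (sqrt pi / a) * ennreal (\<integral>s. normal_density 0 \<sigma> s \<partial>lborel)"
    using \<sigma> by (subst nn_integral_cmult) (auto simp: nn_integral_eq_integral)
  finally show ?thesis using \<sigma> by simp
qed

text \<open>The kernel is the integral of 2 a exp (-s^2 a^2) over a from 0 to y. After exchanging
  the integrals, the Gaussian integral over s is sqrt pi / a, and the integrand in a becomes the
  constant 2 sqrt pi.\<close>

lemma nn_integral_Bernstein_kernel:
  fixes y :: real
  assumes "0 \<le> y"
  shows "(\<integral>\<^sup>+s. ennreal ((1 - exp (- (s * y)\<^sup>2)) / s\<^sup>2) \<partial>lborel) = ennreal (2 * sqrt pi * y)"
proof -
  have "(\<integral>\<^sup>+s. ennreal ((1 - exp (- (s * y)\<^sup>2)) / s\<^sup>2) \<partial>lborel)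
      = (\<integral>\<^sup>+s. \<integral>\<^sup>+a. ennreal (2 * a * exp (- (s * a)\<^sup>2)) * indicator {0..y} a \<partial>lborel \<partial>lborel)"
  \<comment> \<open>At s = 0 the quotient is 0 by the convention for division by zero, while the
    inner integral is y^2; the equation holds off this null point.\<close>
  proof (rule nn_integral_cong_AE, rule AE_mp[OF AE_lborel_singleton[of 0]], intro AE_I2 impI)
    fix s :: real assume s: "s \<noteq> 0"
    have "(\<integral>\<^sup>+a. ennreal (2 * a * exp (- (s * a)\<^sup>2)) * indicator {0..y} a \<partial>lborel)
        = ennreal (- exp (- (s * y)\<^sup>2) / s\<^sup>2 - (- exp (- (s * 0)\<^sup>2) / s\<^sup>2))"
      using s assms
      by (intro nn_integral_FTC_Icc[where F = "\<lambda>a. - exp (- (s * a)\<^sup>2) / s\<^sup>2"])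
        (auto intro!: derivative_eq_intros simp: field_simps power2_eq_square)
    then show "ennreal ((1 - exp (- (s * y)\<^sup>2)) / s\<^sup>2)
        = (\<integral>\<^sup>+a. ennreal (2 * a * exp (- (s * a)\<^sup>2)) * indicator {0..y} a \<partial>lborel)"
      by (simp add: diff_divide_distrib)
  qed
  also have "\<dots> = (\<integral>\<^sup>+a. \<integral>\<^sup>+s. ennreal (2 * a * exp (- (s * a)\<^sup>2)) * indicator {0..y} a \<partial>lborel \<partial>lborel)"
    by (rule lborel_pair.Fubini') simp
  also have "\<dots> = (\<integral>\<^sup>+a. ennreal (2 * sqrt pi) * indicator {0..y} a \<partial>lborel)"
  proof (rule nn_integral_cong_AE, rule AE_mp[OF AE_lborel_singleton[of 0]], intro AE_I2 impI)
    fix a :: real assume a: "a \<noteq> 0"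
    show "(\<integral>\<^sup>+s. ennreal (2 * a * exp (- (s * a)\<^sup>2)) * indicator {0..y} a \<partial>lborel)
        = ennreal (2 * sqrt pi) * indicator {0..y} a"
    proof (cases "a \<in> {0..y}")
      case True
      then have "0 < a" using a by auto
      have "(\<integral>\<^sup>+s. ennreal (2 * a * exp (- (s * a)\<^sup>2)) \<partial>lborel)
          = ennreal (2 * a) * (\<integral>\<^sup>+s. ennreal (exp (- (s * a)\<^sup>2)) \<partial>lborel)"
        using \<open>0 < a\<close> by (subst nn_integral_cmult[symmetric]) (auto simp: ennreal_mult)
      also have "\<dots> = ennreal (2 * sqrt pi)"
        using \<open>0 < a\<close> by (simp add: nn_integral_exp_neg_square flip: ennreal_mult)
      finally show ?thesis using True by simp
    qed simp
  qed
  also have "\<dots> = ennreal (2 * sqrt pi * y)"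
    using assms by (simp add: nn_integral_cmult_indicator flip: ennreal_mult)
  finally show ?thesis .
qed

lemma nn_integral_even:
  fixes f :: "real \<Rightarrow> ennreal"
  assumes [measurable]: "f \<in> borel_measurable borel" and even: "\<And>x. f (- x) = f x"
  shows "(\<integral>\<^sup>+x. f x \<partial>lborel) = 2 * (\<integral>\<^sup>+x. f x * indicator {0..} x \<partial>lborel)"
proof -
  have "(\<integral>\<^sup>+x. f x \<partial>lborel) = (\<integral>\<^sup>+x. f x * indicator {0..} x + f x * indicator {..0} x \<partial>lborel)"
    by (rule nn_integral_cong_AE, rule AE_mp[OF AE_lborel_singleton[of 0]])
      (auto split: split_indicator)
  also have "\<dots> = (\<integral>\<^sup>+x. f x * indicator {0..} x \<partial>lborel) + (\<integral>\<^sup>+x. f x * indicator {..0} x \<partial>lborel)"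
    by (rule nn_integral_add) auto
  also have "(\<integral>\<^sup>+x. f x * indicator {..0} x \<partial>lborel) = (\<integral>\<^sup>+x. f x * indicator {0..} x \<partial>lborel)"
    by (subst nn_integral_real_affine[where c = "-1" and t = 0])
      (auto intro!: nn_integral_cong simp: even split: split_indicator)
  finally show ?thesis by (simp add: mult_2)
qed

lemma nn_integral_even_FTC:
  fixes f F :: "real \<Rightarrow> real"
  assumes [measurable]: "f \<in> borel_measurable borel" and even: "\<And>x. f (- x) = f x"
    and F: "\<And>x. 0 \<le> x \<Longrightarrow> DERIV F x :> f x" and nn: "\<And>x. 0 \<le> x \<Longrightarrow> 0 \<le> f x"
    and lim: "(F \<longlongrightarrow> T) at_top" and "F 0 = 0"
  shows "(\<integral>\<^sup>+x. ennreal (f x) \<partial>lborel) = ennreal (2 * T)"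
proof -
  have mono: "F 0 \<le> F x" if "0 \<le> x" for x
    by (rule DERIV_nonneg_imp_nondecreasing[OF that]) (use F nn in blast)
  have "0 \<le> T"
    by (rule tendsto_lowerbound[OF lim])
      (use mono \<open>F 0 = 0\<close> in \<open>auto intro!: eventually_at_top_linorderI[of 0]\<close>)
  have "(\<integral>\<^sup>+x. ennreal (f x) \<partial>lborel) = 2 * ennreal (T - F 0)"
    using nn_integral_FTC_atLeast[of f 0 F T] F nn lim by (subst nn_integral_even) (auto simp: even)
  then show ?thesis
    using \<open>F 0 = 0\<close> \<open>0 \<le> T\<close> by (simp add: ennreal_mult)
qed

section \<open>Beta-type integrals and the coefficients they produce\<close>

lemma nn_integral_cauchy_kernel:
  "(\<integral>\<^sup>+s. ennreal (1 / (1 + s\<^sup>2)) \<partial>lborel) = ennreal pi"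
proof -
  have "(\<integral>\<^sup>+s. ennreal (1 / (1 + s\<^sup>2)) \<partial>lborel) = ennreal (2 * (pi / 2))"
  proof (rule nn_integral_even_FTC[where F = arctan])
    show "DERIV arctan x :> 1 / (1 + x\<^sup>2)" for x
      using DERIV_arctan[of x] by (simp add: divide_inverse)
  qed (auto simp: tendsto_arctan_at_top)
  then show ?thesis by simp
qed

text \<open>The power series coefficients of sqrt (1 - x); their squares are the coefficients of
  2F1(-1/2, -1/2; 1; x).\<close>

definition hyp_coeff :: "nat \<Rightarrow> real" where
  "hyp_coeff n = pochhammer (-1/2) n / fact n"

lemma hyp_coeff_0: "hyp_coeff 0 = 1" by (simp add: hyp_coeff_def)

lemma hyp_coeff_Suc: "hyp_coeff (Suc n) = hyp_coeff n * ((2 * real n - 1) / (2 * (real n + 1)))"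
  by (simp add: hyp_coeff_def pochhammer_Suc field_simps)

lemma hyp_coeff_Suc_nonpos: "hyp_coeff (Suc n) \<le> 0"
proof (induction n)
  case (Suc n)
  then show ?case
    by (subst hyp_coeff_Suc) (rule mult_nonpos_nonneg; simp)
qed (simp add: hyp_coeff_Suc hyp_coeff_0)

text \<open>This is the Beta value B(n + 1/2, 3/2). Primitives are built by recursion on n:
  integration by parts leaves a boundary term that vanishes at 0 and at infinity, and its factor (2
  n + 1) / (2 (n + 2)) is the recursion of \<open>hyp_coeff\<close>. The minus sign compensates
  \<open>hyp_coeff_Suc_nonpos\<close>.\<close>

lemma nn_integral_beta_kernel:
  "(\<integral>\<^sup>+s. ennreal (s ^ (2 * n) / (1 + s\<^sup>2) ^ (n + 2)) \<partial>lborel) = ennreal (- pi * hyp_coeff (Suc n))"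
proof -
  have nz: "1 + s\<^sup>2 \<noteq> 0" "0 < 1 + s\<^sup>2" for s :: real
    by (auto simp: add_pos_nonneg add_nonneg_eq_0_iff)
  have "\<exists>F. (\<forall>s. DERIV F s :> s ^ (2 * n) / (1 + s\<^sup>2) ^ (n + 2)) \<and> F 0 = 0 \<and>
      (F \<longlongrightarrow> - pi / 2 * hyp_coeff (Suc n)) at_top"
  proof (induction n)
    case 0
    define F where "F s = (arctan s + s / (1 + s\<^sup>2)) / 2" for s :: real
    have "DERIV F s :> s ^ (2 * 0) / (1 + s\<^sup>2) ^ (0 + 2)" for s
    proof -
      define q where "q = 1 + s\<^sup>2"
      have q: "q \<noteq> 0" "s * (2 * s) = 2 * (q - 1)" using nz(1)[of s] by (auto simp: q_def power2_eq_square)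
      have "((\<lambda>s. 1 + s\<^sup>2) has_real_derivative 2 * s) (at s)"
        by (auto intro!: derivative_eq_intros)
      then have "((\<lambda>s. s / (1 + s\<^sup>2)) has_real_derivative (1 * q - s * (2 * s)) / (q * q)) (at s)"
        unfolding q_def by (intro DERIV_divide DERIV_ident nz(1))
      then have "DERIV F s :> (inverse q + (1 * q - s * (2 * s)) / (q * q)) / 2"
        unfolding F_def by (intro DERIV_cdivide DERIV_add) (auto simp: q_def DERIV_arctan)
      also have "(inverse q + (1 * q - s * (2 * s)) / (q * q)) / 2 = 1 / q\<^sup>2"
        unfolding q(2) using q(1) by (simp add: field_simps power2_eq_square)
      finally show ?thesis by (simp add: q_def power2_eq_square)
    qed
    moreover have "((\<lambda>s::real. s / (1 + s\<^sup>2)) \<longlongrightarrow> 0) at_top" by real_asymp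
    then have "(F \<longlongrightarrow> (pi / 2 + 0) / 2) at_top"
      unfolding F_def[abs_def] by (intro tendsto_intros tendsto_arctan_at_top) auto
    moreover have F0: "F 0 = 0" by (simp add: F_def)
    ultimately show ?case using F0 by (intro exI[of _ F]) (auto simp: hyp_coeff_Suc hyp_coeff_0)
  next
    case (Suc n)
    then obtain F where F: "\<And>s. DERIV F s :> s ^ (2 * n) / (1 + s\<^sup>2) ^ (n + 2)" "F 0 = 0"
      and lim: "(F \<longlongrightarrow> - pi / 2 * hyp_coeff (Suc n)) at_top" by blast
    \<comment> \<open>Differentiating s^(2n+1) / (1 + s^2)^(n+2) gives 2 n + 1 times the n-th
      integrand minus 2 (n + 2) times the next one; solving for the latter yields this
      primitive.\<close>
    define G where "G s = ((2 * real n + 1) * F s - s ^ (2 * n + 1) / (1 + s\<^sup>2) ^ (n + 2)) / (2 * (real n + 2))" for s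
    have dG: "DERIV G s :> s ^ (2 * Suc n) / (1 + s\<^sup>2) ^ (Suc n + 2)" for s
    proof -
      define q where "q = 1 + s\<^sup>2"
      have q: "q \<noteq> 0" using nz(1)[of s] by (simp add: q_def)
      have d: "((\<lambda>s. s ^ (2 * n + 1) / (1 + s\<^sup>2) ^ (n + 2)) has_real_derivative
         (real (2 * n + 1) * s ^ (2 * n) * q ^ (n + 2) - s ^ (2 * n + 1) * (real (n + 2) * q ^ (n + 1) * (2 * s)))
           / (q ^ (n + 2) * q ^ (n + 2))) (at s)"
      proof -
        have "((\<lambda>s. 1 + s\<^sup>2) has_real_derivative 2 * s) (at s)"
          by (auto intro!: derivative_eq_intros)
        then have "((\<lambda>s. (1 + s\<^sup>2) ^ (n + 2)) has_real_derivative real (n + 2) * q ^ (n + 1) * (2 * s)) (at s)"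
          using DERIV_power[of "\<lambda>s. 1 + s\<^sup>2" "2 * s" s UNIV "n + 2"] by (simp add: q_def mult_ac)
        moreover have "((\<lambda>s. s ^ (2 * n + 1)) has_real_derivative real (2 * n + 1) * s ^ (2 * n)) (at s)"
          using DERIV_pow[of "2 * n + 1" s UNIV] by simp
        ultimately show ?thesis
          unfolding q_def using nz(1) by (intro DERIV_divide) auto
      qed
      have e: "(real (2 * n + 1) * s ^ (2 * n) * q ^ (n + 2) - s ^ (2 * n + 1) * (real (n + 2) * q ^ (n + 1) * (2 * s)))
           / (q ^ (n + 2) * q ^ (n + 2))
         = (2 * real n + 1) * (s ^ (2 * n) / q ^ (n + 2)) - 2 * (real n + 2) * (s ^ (2 * Suc n) / q ^ (Suc n + 2))"
      proof -
        define S Q where "S = s ^ (2 * n)" and "Q = q ^ n"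
        have "Q \<noteq> 0" using q by (simp add: Q_def)
        have "(a * S * (Q * q * q) - s * S * (b * (Q * q) * (2 * s))) / (Q * q * q * (Q * q * q))
            = a * (S / (Q * q * q)) - 2 * b * (S * s * s / (Q * q * q * q))" for a b :: real
          using q \<open>Q \<noteq> 0\<close> by (simp add: divide_simps) (simp add: algebra_simps)
        from this[of "real (2 * n + 1)" "real (n + 2)"] show ?thesis
          by (simp add: S_def Q_def power_add power2_eq_square mult_ac add_ac)
      qed
      have "DERIV G s :> ((2 * real n + 1) * (s ^ (2 * n) / q ^ (n + 2)) -
          ((2 * real n + 1) * (s ^ (2 * n) / q ^ (n + 2)) - 2 * (real n + 2) * (s ^ (2 * Suc n) / q ^ (Suc n + 2))))
            / (2 * (real n + 2))"
        unfolding G_def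
        by (intro DERIV_cdivide DERIV_diff DERIV_cmult F(1)[of s, folded q_def] d[unfolded e])
      then show ?thesis by (simp add: q_def)
    qed
    have "((\<lambda>s. s ^ (2 * n + 1) / (1 + s\<^sup>2) ^ (n + 2)) \<longlongrightarrow> (0::real)) at_top"
    proof (rule tendsto_sandwich[where f = "\<lambda>_. 0" and h = "\<lambda>s. s / (1 + s\<^sup>2)"])
      show "\<forall>\<^sub>F s in at_top. s ^ (2 * n + 1) / (1 + s\<^sup>2) ^ (n + 2) \<le> s / (1 + s\<^sup>2 :: real)"
      proof (intro eventually_at_top_linorderI[of 0])
        fix s :: real assume s: "0 \<le> s"
        have "s ^ (2 * n) \<le> (1 + s\<^sup>2) ^ n"
          by (auto simp: power_mult intro!: power_mono)
        also have "\<dots> \<le> (1 + s\<^sup>2) ^ (n + 1)"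
          by (intro power_increasing) auto
        finally have "s ^ (2 * n) / (1 + s\<^sup>2) ^ (n + 1) \<le> 1"
          using nz(2)[of s] by (simp add: divide_le_eq_1)
        then have "s / (1 + s\<^sup>2) * (s ^ (2 * n) / (1 + s\<^sup>2) ^ (n + 1)) \<le> s / (1 + s\<^sup>2)"
          using s by (intro mult_left_le) auto
        then show "s ^ (2 * n + 1) / (1 + s\<^sup>2) ^ (n + 2) \<le> s / (1 + s\<^sup>2)"
          by simp
      qed
      show "\<forall>\<^sub>F s in at_top. 0 \<le> s ^ (2 * n + 1) / (1 + s\<^sup>2 :: real) ^ (n + 2)"
        by (intro eventually_at_top_linorderI[of 0]) simp
      show "((\<lambda>s::real. s / (1 + s\<^sup>2)) \<longlongrightarrow> 0) at_top" by real_asymp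
    qed simp
    then have limG: "(G \<longlongrightarrow> ((2 * real n + 1) * (- pi / 2 * hyp_coeff (Suc n)) - 0) / (2 * (real n + 2))) at_top"
      unfolding G_def[abs_def] by (intro tendsto_intros lim) auto
    have eqG: "((2 * real n + 1) * (- pi / 2 * hyp_coeff (Suc n)) - 0) / (2 * (real n + 2))
        = - pi / 2 * hyp_coeff (Suc (Suc n))"
      unfolding hyp_coeff_Suc[of "Suc n"] by (simp add: field_simps)
    have "G 0 = 0" by (simp add: G_def F(2))
    then show ?case by (intro exI[of _ G] conjI allI dG limG[unfolded eqG])
  qed
  then obtain F where F: "\<And>s. DERIV F s :> s ^ (2 * n) / (1 + s\<^sup>2) ^ (n + 2)" "F 0 = 0"
      and lim: "(F \<longlongrightarrow> - pi / 2 * hyp_coeff (Suc n)) at_top" by blast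
  have "(\<integral>\<^sup>+s. ennreal (s ^ (2 * n) / (1 + s\<^sup>2) ^ (n + 2)) \<partial>lborel)
      = ennreal (2 * (- pi / 2 * hyp_coeff (Suc n)))"
    by (rule nn_integral_even_FTC[OF _ _ F(1) _ lim F(2)]) auto
  then show ?thesis by simp
qed

subsection \<open>The hypergeometric term\<close>

text \<open>The ratio of consecutive squares tends to 1, so the ratio test is silent. A Raabe-type
  majorant works instead: a multiple c of (n + 1) times the next square dominates the tail. In the
  induction step (2n+1)^2 / (4 (n+2)) is at most n + 1/8, which is 7/8 below n + 1, hence c = 8/7;
  the start n = 0 gives 1 + 8/7 * 1/4 = 9/7.\<close>

lemma summable_hyp_coeff_sq: "summable (\<lambda>n. (hyp_coeff n)\<^sup>2)"
proof (rule summableI_nonneg_bounded)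
  show "(\<Sum>k<n. (hyp_coeff k)\<^sup>2) \<le> 9 / 7" for n
  proof -
    have "(\<Sum>k\<le>n. (hyp_coeff k)\<^sup>2) + 8 / 7 * ((real n + 1) * (hyp_coeff (Suc n))\<^sup>2) \<le> 9 / 7"
    proof (induction n)
      case 0
      show ?case by (simp add: hyp_coeff_Suc hyp_coeff_0 power2_eq_square)
    next
      case (Suc n)
      define b where "b = (hyp_coeff (Suc n))\<^sup>2"
      have b2: "(hyp_coeff (Suc (Suc n)))\<^sup>2 = b * ((2 * real n + 1)\<^sup>2 / (4 * (real n + 2)\<^sup>2))"
        unfolding hyp_coeff_Suc[of "Suc n"] b_def by (simp add: power_divide) (simp add: power2_eq_square algebra_simps)
      have "1 + 8 / 7 * ((real n + 2) * ((2 * real n + 1)\<^sup>2 / (4 * (real n + 2)\<^sup>2))) \<le> 8 / 7 * (real n + 1)"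
      proof -
        have "(real n + 2) * ((2 * real n + 1)\<^sup>2 / (4 * (real n + 2)\<^sup>2)) = (2 * real n + 1)\<^sup>2 / (4 * (real n + 2))"
          by (simp add: power2_eq_square)
        also have "\<dots> \<le> real n + 1 / 8"
          by (simp add: field_simps power2_eq_square)
        finally have X: "(real n + 2) * ((2 * real n + 1)\<^sup>2 / (4 * (real n + 2)\<^sup>2)) \<le> real n + 1 / 8" .
        have "1 + 8 / 7 * x \<le> 8 / 7 * (real n + 1)" if "x \<le> real n + 1 / 8" for x
          using that by simp
        from this[OF X] show ?thesis .
      qed
      then have "b * (1 + 8 / 7 * ((real n + 2) * ((2 * real n + 1)\<^sup>2 / (4 * (real n + 2)\<^sup>2)))) \<le> b * (8 / 7 * (real n + 1))"
        by (rule mult_left_mono) (simp add: b_def)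
      then have "b + 8 / 7 * ((real n + 2) * (hyp_coeff (Suc (Suc n)))\<^sup>2) \<le> 8 / 7 * ((real n + 1) * b)"
        unfolding b2 by (simp add: algebra_simps)
      then show ?case using Suc.IH by (simp add: b_def add.commute)
    qed
    moreover have "(\<Sum>k<n. (hyp_coeff k)\<^sup>2) \<le> (\<Sum>k\<le>n. (hyp_coeff k)\<^sup>2)"
      by (intro sum_mono2) auto
    moreover have "0 \<le> 8 / 7 * ((real n + 1) * (hyp_coeff (Suc n))\<^sup>2)" by simp
    ultimately show ?thesis by linarith
  qed
qed simp

text \<open>\<open>hyp2F1\<close> unfolds to a bare \<open>suminf\<close>, so convergence has to be
  supplied. The ratio of consecutive terms tends to y, hence is eventually below the midpoint
  \<open>c\<close> of y and 1.\<close>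

lemma hyp2F1_three_halves_sums:
  fixes y :: real
  assumes "0 \<le> y" "y < 1"
  shows "(\<lambda>n. (pochhammer (3/2) n / fact n)\<^sup>2 * y ^ n) sums hyp2F1 (3/2) (3/2) 1 y"
proof -
  define f where "f n = (pochhammer (3/2 :: real) n / fact n)\<^sup>2 * y ^ n" for n
  define c where "c = (1 + y) / 2"
  have "((\<lambda>n. ((real n + 3/2) / (real n + 1))\<^sup>2 * y) \<longlongrightarrow> y) at_top"
    by real_asymp
  moreover have "y < c" "c < 1" using assms by (auto simp: c_def)
  ultimately obtain N where N: "\<And>n. N \<le> n \<Longrightarrow> ((real n + 3/2) / (real n + 1))\<^sup>2 * y < c"
    using order_tendstoD(2) by (fastforce simp: eventually_at_top_linorder)
  have rec: "f (Suc n) = ((real n + 3/2) / (real n + 1))\<^sup>2 * y * f n" for n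
    by (simp add: f_def pochhammer_Suc power_divide power_mult_distrib divide_simps mult_ac add_ac)
  have "summable f"
  proof (rule summable_ratio_test[OF \<open>c < 1\<close>])
    fix n assume "N \<le> n"
    have "norm (f (Suc n)) = ((real n + 3/2) / (real n + 1))\<^sup>2 * y * norm (f n)"
      unfolding rec using assms by (simp add: abs_mult)
    also have "\<dots> \<le> c * norm (f n)"
      using N[OF \<open>N \<le> n\<close>] by (intro mult_right_mono) auto
    finally show "norm (f (Suc n)) \<le> c * norm (f n)" .
  qed
  moreover have "hyp2F1 (3/2) (3/2) 1 y = suminf f"
    by (simp add: hyp2F1_def eval_fps_def f_def[abs_def] power2_eq_square flip: pochhammer_fact)
  ultimately show ?thesis by (simp add: f_def[abs_def] summable_sums)
qed

text \<open>Euler's transformation \<open>2F1(-1/2, -1/2; 1; y) = (1 - y)\<^sup>2 2F1(3/2, 3/2; 1; y)\<close>;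
  coefficientwise it is a second-difference identity.\<close>

lemma hyp2F1_Euler_three_halves:
  fixes y :: real
  assumes "0 \<le> y" "y < 1"
  shows "(\<lambda>n. (hyp_coeff n)\<^sup>2 * y ^ n) sums ((1 - y)\<^sup>2 * hyp2F1 (3/2) (3/2) 1 y)"
proof -
  define a where "a n = (pochhammer (3/2 :: real) n / fact n)\<^sup>2" for n
  define H where "H = hyp2F1 (3/2) (3/2) 1 y"
  define f where "f n = a n * y ^ n" for n
  have f: "f sums H"
    using hyp2F1_three_halves_sums[OF assms] by (simp add: f_def[abs_def] a_def H_def)
  have coeff: "(hyp_coeff (n + 2))\<^sup>2 = a (n + 2) - 2 * a (n + 1) + a n" for n
  proof -
    define q where "q = pochhammer (3/2 :: real) n"
    \<comment> \<open>The first two factors -1/2 and 1/2 split off and shift the base from -1/2 to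
      3/2.\<close>
    have p: "pochhammer (-1/2 :: real) (n + 2) = - 1/4 * q"
    proof -
      have "pochhammer (-1/2 :: real) (2 + n) = pochhammer (-1/2) 2 * pochhammer (-1/2 + of_nat 2) n"
        by (rule pochhammer_product')
      then show ?thesis by (simp add: q_def pochhammer_rec numeral_2_eq_2 add.commute)
    qed
    have a: "a n = q\<^sup>2 * ((real n + 1) * (real n + 2))\<^sup>2 / (fact (n + 2))\<^sup>2"
      "a (n + 1) = q\<^sup>2 * ((real n + 3/2) * (real n + 2))\<^sup>2 / (fact (n + 2))\<^sup>2"
      "a (n + 2) = q\<^sup>2 * ((real n + 3/2) * (real n + 5/2))\<^sup>2 / (fact (n + 2))\<^sup>2"
      by (simp_all add: a_def q_def pochhammer_Suc power_mult_distrib power_divide divide_simps add_ac)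
    have "a (n + 2) - 2 * a (n + 1) + a n = q\<^sup>2 / (fact (n + 2))\<^sup>2 *
       (((real n + 3/2) * (real n + 5/2))\<^sup>2 - 2 * ((real n + 3/2) * (real n + 2))\<^sup>2
        + ((real n + 1) * (real n + 2))\<^sup>2)"
      unfolding a by (simp only: diff_divide_distrib add_divide_distrib ring_distribs times_divide_eq_left times_divide_eq_right mult_ac)
    \<comment> \<open>All powers of n cancel. The constant left over is the square of the factor
      -1/4 in \<open>p\<close>.\<close>
    also have "((real n + 3/2) * (real n + 5/2))\<^sup>2 - 2 * ((real n + 3/2) * (real n + 2))\<^sup>2
        + ((real n + 1) * (real n + 2))\<^sup>2 = 1 / 16"
      by (simp add: power2_eq_square field_simps)
    also have "q\<^sup>2 / (fact (n + 2))\<^sup>2 * (1 / 16) = (hyp_coeff (n + 2))\<^sup>2"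
      unfolding hyp_coeff_def p by (simp add: power_divide power_mult_distrib power2_eq_square)
    finally show ?thesis ..
  qed
  have f01: "f 0 = 1" "f 1 = 9/4 * y" by (simp_all add: f_def a_def power2_eq_square)
  \<comment> \<open>The coefficients of (1 - y)^2 applied to shifted copies of the series. The
    shifts drop \<open>f 0\<close> and \<open>f 1\<close>; what this leaves, 1 + y/4, is the part of
    the target series below index 2.\<close>
  have "(\<lambda>n. f (n + 2) - 2 * y * f (n + 1) + y\<^sup>2 * f n)
      sums ((H - (f 0 + f 1)) - 2 * y * (H - 1) + y\<^sup>2 * H)"
    using sums_split_initial_segment[OF f, of 2] sums_split_initial_segment[OF f, of 1] f01(1)
    by (intro sums_add sums_diff sums_mult f) (simp_all add: numeral_2_eq_2)
  also have "(\<lambda>n. f (n + 2) - 2 * y * f (n + 1) + y\<^sup>2 * f n) = (\<lambda>n. (hyp_coeff (n + 2))\<^sup>2 * y ^ (n + 2))"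
    unfolding coeff by (simp add: f_def fun_eq_iff algebra_simps power2_eq_square)
  finally have "(\<lambda>n. (hyp_coeff (n + 2))\<^sup>2 * y ^ (n + 2))
      sums ((1 - y)\<^sup>2 * H - (\<Sum>i<2. (hyp_coeff i)\<^sup>2 * y ^ i))"
    by (rule back_subst[of "\<lambda>x. _ sums x"])
      (simp only: f01, simp add: numeral_2_eq_2 hyp_coeff_0 hyp_coeff_Suc power2_eq_square algebra_simps)
  then show ?thesis
    unfolding H_def by (subst (asm) sums_iff_shift) (simp add: H_def)
qed

text \<open>Below 1 this is Euler's transformation. At 1 the M-test with majorant
  \<open>(hyp_coeff n)\<^sup>2\<close> makes the series continuous on the closed interval, so its
  value at 1 is the left limit in \<open>hyp_term\<close>. This covers fully correlated entries,
  |rho_ij| = 1.\<close>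

lemma hyp_term_sums:
  assumes x: "0 \<le> x" "x \<le> 1"
  shows "(\<lambda>n. (hyp_coeff n)\<^sup>2 * x ^ n) sums hyp_term x"
proof -
  define G where "G y = (\<Sum>n. (hyp_coeff n)\<^sup>2 * y ^ n)" for y :: real
  define f where "f y = (1 - y)\<^sup>2 * hyp2F1 (3/2) (3/2) 1 y" for y :: real
  have fG: "f y = G y" if "0 \<le> y" "y < 1" for y
    using hyp2F1_Euler_three_halves[OF that] by (simp add: f_def G_def sums_iff)
  have bd: "norm ((hyp_coeff n)\<^sup>2 * y ^ n) \<le> (hyp_coeff n)\<^sup>2" if "y \<in> {0..1}" for n and y :: real
    using that by (simp add: abs_mult mult_left_le power_le_one)
  have "uniform_limit {0..1} (\<lambda>n y. \<Sum>i<n. (hyp_coeff i)\<^sup>2 * y ^ i) G sequentially"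
    unfolding G_def using Weierstrass_m_test[OF bd summable_hyp_coeff_sq] .
  then have "continuous_on {0..1} G"
    by (rule uniform_limit_theorem[rotated]) (auto intro!: continuous_intros always_eventually)
  then have "(G \<longlongrightarrow> G 1) (at_left 1)"
    using at_within_Icc_at_left[of 0 "1::real"] by (simp add: continuous_on_def) (metis atLeastAtMost_iff order_refl zero_le_one)
  moreover have "\<forall>\<^sub>F y in at_left 1. G y = f y"
    unfolding eventually_at_left_field by (rule exI[of _ 0]) (auto simp: fG)
  ultimately have "(f \<longlongrightarrow> G 1) (at_left 1)"
    using tendsto_cong by blast
  then have "Lim (at_left 1) f = G 1"
    by (intro tendsto_Lim) auto
  then have "hyp_term x = G x"
    using x fG[of x] unfolding hyp_term_def f_def[abs_def] Let_def by auto
  moreover have "summable (\<lambda>n. (hyp_coeff n)\<^sup>2 * x ^ n)"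
    using bd x by (intro summable_comparison_test'[OF summable_hyp_coeff_sq]) auto
  ultimately show ?thesis by (simp add: G_def summable_sums)
qed

subsection \<open>Gaussian integrals\<close>

lemma char_normal_half_variance:
  "(\<integral>x. cis (k * x) \<partial>density lborel (normal_density 0 (sqrt (1/2)))) = complex_of_real (exp (- k\<^sup>2 / 4))"
proof -
  let ?N = "density lborel (normal_density 0 (sqrt (1/2)))"
  interpret N: prob_space ?N by (rule prob_space_normal_density) simp
  have id: "distributed ?N lborel (\<lambda>x. x) (normal_density 0 (sqrt (1/2)))"
    by (auto simp: distributed_def distr_id2)
  have std: "distributed ?N lborel (\<lambda>x. (x - 0) / sqrt (1/2)) std_normal_density"
    using id by (subst (asm) N.normal_standard_normal_convert) auto
  have "(\<integral>x. cis (k * x) \<partial>?N) = (\<integral>x. iexp (k * sqrt (1/2) * ((x - 0) / sqrt (1/2))) \<partial>?N)"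
    by (intro Bochner_Integration.integral_cong) (simp_all add: cis_conv_exp real_sqrt_divide)
  also have "\<dots> = (\<integral>y. iexp (k * sqrt (1/2) * y) \<partial>distr ?N lborel (\<lambda>x. (x - 0) / sqrt (1/2)))"
    by (subst integral_distr) auto
  also have "\<dots> = char std_normal_distribution (k * sqrt (1/2))"
    by (simp only: char_def distributed_distr_eq_density[OF std])
  also have "\<dots> = complex_of_real (exp (- k\<^sup>2 / 4))"
    by (simp add: char_std_normal_distribution power_mult_distrib power_divide)
  finally show ?thesis .
qed

lemma (in prob_space) integrable_cis:
  assumes [measurable]: "f \<in> borel_measurable M"
  shows "integrable M (\<lambda>x. cis (f x))"
  by (rule integrable_const_bound[where B = 1]) (auto simp: cis_conv_exp)

lemma (in prob_space) expectation_cis_std_complex_normal: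
  assumes z: "std_complex_normal M z"
  shows "expectation (\<lambda>\<omega>. cis (w \<bullet> z \<omega>)) = complex_of_real (exp (- (cmod w)\<^sup>2 / 4))"
proof -
  have R: "distributed M lborel (\<lambda>\<omega>. Re (z \<omega>)) (normal_density 0 (sqrt (1/2)))"
    and I: "distributed M lborel (\<lambda>\<omega>. Im (z \<omega>)) (normal_density 0 (sqrt (1/2)))"
    and ind: "indep_var borel (\<lambda>\<omega>. Re (z \<omega>)) borel (\<lambda>\<omega>. Im (z \<omega>))"
    using z by (auto simp: std_complex_normal_def)
  have [measurable]: "(\<lambda>\<omega>. Re (z \<omega>)) \<in> borel_measurable M" "(\<lambda>\<omega>. Im (z \<omega>)) \<in> borel_measurable M"
    using distributed_measurable[OF R] distributed_measurable[OF I] by simp_all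
  have one: "expectation (\<lambda>\<omega>. cis (k * X \<omega>)) = complex_of_real (exp (- k\<^sup>2 / 4))"
    if X: "distributed M lborel X (normal_density 0 (sqrt (1/2)))" for k X
  proof -
    have [measurable]: "X \<in> borel_measurable M" using distributed_measurable[OF X] by simp
    have "expectation (\<lambda>\<omega>. cis (k * X \<omega>)) = (\<integral>x. cis (k * x) \<partial>distr M lborel X)"
      by (subst integral_distr) (auto simp: cis_conv_exp)
    then show ?thesis by (simp add: distributed_distr_eq_density[OF X] char_normal_half_variance)
  qed
  have "expectation (\<lambda>\<omega>. cis (w \<bullet> z \<omega>))
      = expectation (\<lambda>\<omega>. cis (Re w * Re (z \<omega>)) * cis (Im w * Im (z \<omega>)))"
    by (simp add: inner_complex_def cis_mult)
  also have "\<dots> = expectation (\<lambda>\<omega>. cis (Re w * Re (z \<omega>))) * expectation (\<lambda>\<omega>. cis (Im w * Im (z \<omega>)))"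
    using indep_var_compose[OF ind, of "\<lambda>x. cis (Re w * x)" borel "\<lambda>x. cis (Im w * x)" borel]
    by (intro indep_var_lebesgue_integral integrable_cis) (auto simp: comp_def cis_conv_exp)
  also have "\<dots> = complex_of_real (exp (- (cmod w)\<^sup>2 / 4))"
    by (simp add: one[OF R] one[OF I] cmod_power2 add_divide_distrib diff_divide_distrib flip: exp_add of_real_mult)
  finally show ?thesis .
qed

lemma std_complex_normal_vec_measurable:
  assumes "prob_space M" "std_complex_normal_vec M u"
  shows "(\<lambda>\<omega>. u \<omega> $ i) \<in> borel_measurable M" "(\<lambda>\<omega>. cdot p (u \<omega>)) \<in> borel_measurable M"
proof -
  interpret prob_space M by fact
  have *: "(\<lambda>\<omega>. u \<omega> $ i) \<in> borel_measurable M" for i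
    using assms(2) unfolding std_complex_normal_vec_def indep_vars_def by auto
  then show "(\<lambda>\<omega>. u \<omega> $ i) \<in> borel_measurable M" .
  show "(\<lambda>\<omega>. cdot p (u \<omega>)) \<in> borel_measurable M"
    unfolding cdot_def using * by measurable
qed

lemma norm_vec_sq: "(norm (x :: complex ^ 'k))\<^sup>2 = (\<Sum>i\<in>UNIV. (cmod (x $ i))\<^sup>2)"
  by (simp add: norm_vec_def L2_set_def sum_nonneg)

lemma (in prob_space) expectation_cis_std_complex_normal_vec:
  assumes u: "std_complex_normal_vec M u"
  shows "expectation (\<lambda>\<omega>. cis (w \<bullet> u \<omega>)) = complex_of_real (exp (- (norm w)\<^sup>2 / 4))"
proof -
  note [measurable] = std_complex_normal_vec_measurable[OF prob_space_axioms u]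
  have cis_sum: "cis (\<Sum>i\<in>A. f i) = (\<Prod>i\<in>A. cis (f i))" if "finite A" for A :: "'b set" and f
    using that by (induction A rule: finite_induct) (auto simp flip: cis_mult)
  have "expectation (\<lambda>\<omega>. cis (w \<bullet> u \<omega>)) = expectation (\<lambda>\<omega>. \<Prod>i\<in>UNIV. cis (w $ i \<bullet> u \<omega> $ i))"
    by (simp add: inner_vec_def cis_sum)
  also have "\<dots> = (\<Prod>i\<in>UNIV. expectation (\<lambda>\<omega>. cis (w $ i \<bullet> u \<omega> $ i)))"
  proof (rule indep_vars_lebesgue_integral)
    show "indep_vars (\<lambda>_. borel) (\<lambda>i \<omega>. cis (w $ i \<bullet> u \<omega> $ i)) UNIV"
      using u unfolding std_complex_normal_vec_def
      by (intro indep_vars_compose2[where Y = "\<lambda>i z. cis (w $ i \<bullet> z)" and M' = "\<lambda>_. borel"])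
        (auto simp: cis_conv_exp)
  qed (auto intro!: integrable_cis)
  also have "\<dots> = (\<Prod>i\<in>UNIV. complex_of_real (exp (- (cmod (w $ i))\<^sup>2 / 4)))"
    using u by (intro prod.cong expectation_cis_std_complex_normal) (auto simp: std_complex_normal_vec_def)
  also have "\<dots> = complex_of_real (exp (- (norm w)\<^sup>2 / 4))"
  proof -
    have "- (norm w)\<^sup>2 / 4 = (\<Sum>i\<in>UNIV. - (cmod (w $ i))\<^sup>2 / 4)"
      by (simp add: norm_vec_sq sum_divide_distrib sum_negf)
    then show ?thesis by (simp only: exp_sum[OF finite] of_real_prod)
  qed
  finally show ?thesis .
qed

text \<open>A concrete CN(0,1) law, serving as auxiliary randomness outside the given probability
  space. As an image of a product measure it lets integrals be computed one real coordinate at a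
  time.\<close>

definition complex_gaussian :: "complex measure" where
  "complex_gaussian =
     (let N = density lborel (normal_density 0 (sqrt (1/2)))
      in distr (N \<Otimes>\<^sub>M N) borel (\<lambda>(x, y). Complex x y))"

lemma measurable_Complex [measurable]: "(\<lambda>(x, y). Complex x y) \<in> borel_measurable (borel \<Otimes>\<^sub>M borel)"
proof -
  have "(\<lambda>(x, y). Complex x y) = (\<lambda>p. complex_of_real (fst p) + \<i> * complex_of_real (snd p))"
    by (auto simp: complex_eq_iff)
  then show ?thesis by simp
qed

lemma sets_complex_gaussian [measurable_cong, simp]: "sets complex_gaussian = sets borel"
  by (simp add: complex_gaussian_def Let_def)

lemma prob_space_complex_gaussian: "prob_space complex_gaussian"
proof -
  let ?N = "density lborel (normal_density 0 (sqrt (1/2)))"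
  interpret N: prob_space ?N by (rule prob_space_normal_density) simp
  interpret NN: pair_prob_space ?N ?N ..
  have "sets (?N \<Otimes>\<^sub>M ?N) = sets (borel \<Otimes>\<^sub>M borel)" by (intro sets_pair_measure_cong) auto
  then show ?thesis
    unfolding complex_gaussian_def Let_def by (intro NN.prob_space_distr) (simp cong: measurable_cong_sets)
qed

lemma char_complex_gaussian:
  "(\<integral>g. cis (w \<bullet> g) \<partial>complex_gaussian) = complex_of_real (exp (- (cmod w)\<^sup>2 / 4))"
proof -
  let ?N = "density lborel (normal_density 0 (sqrt (1/2)))"
  interpret N: prob_space ?N by (rule prob_space_normal_density) simp
  interpret NN: pair_prob_space ?N ?N ..
  have s: "sets (?N \<Otimes>\<^sub>M ?N) = sets (borel \<Otimes>\<^sub>M borel)" by (intro sets_pair_measure_cong) auto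
  have "(\<integral>g. cis (w \<bullet> g) \<partial>complex_gaussian)
      = (\<integral>p. cis (Re w * fst p) * cis (Im w * snd p) \<partial>(?N \<Otimes>\<^sub>M ?N))"
    unfolding complex_gaussian_def Let_def
    by (subst integral_distr)
      (auto simp: cis_conv_exp s inner_complex_def case_prod_beta distrib_left ring_distribs exp_add
        cong: measurable_cong_sets)
  also have "\<dots> = (\<integral>x. \<integral>y. cis (Re w * x) * cis (Im w * y) \<partial>?N \<partial>?N)"
    using s
    by (subst NN.integral_fst'[symmetric])
      (auto intro!: NN.P.integrable_const_bound[where B = 1] simp: norm_mult cis_conv_exp
        cong: measurable_cong_sets)
  also have "\<dots> = complex_of_real (exp (- (Re w)\<^sup>2 / 4)) * complex_of_real (exp (- (Im w)\<^sup>2 / 4))"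
    by (simp add: char_normal_half_variance)
  also have "\<dots> = complex_of_real (exp (- (cmod w)\<^sup>2 / 4))"
    by (simp add: cmod_power2 add_divide_distrib diff_divide_distrib flip: exp_add of_real_mult)
  finally show ?thesis .
qed

text \<open>Linearisation of the square (the Hubbard-Stratonovich device): a Gaussian in z becomes
  an average of phases that are real linear in z. The factor 2 offsets the 1/4 in the characteristic
  function.\<close>

lemma exp_neg_cmod_sq_eq_integral:
  "complex_of_real (exp (- (cmod z)\<^sup>2)) = (\<integral>g. cis (2 * (g \<bullet> z)) \<partial>complex_gaussian)"
proof -
  have "(2 * z) \<bullet> g = 2 * (g \<bullet> z)" for g by (simp add: inner_complex_def algebra_simps)
  moreover have "- (cmod (2 * z))\<^sup>2 / 4 = - (cmod z)\<^sup>2" by (simp add: norm_mult power_mult_distrib)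
  ultimately show ?thesis using char_complex_gaussian[of "2 * z"] by simp
qed

text \<open>Completing the square, with q = 1 + P: the integrand times the density is a constant
  times the normal density of mean -d/q and variance 1/(2q), which has mass 1.\<close>

lemma nn_integral_normal_exp_quadratic:
  fixes P d :: real
  assumes "1 + P > 0"
  shows "(\<integral>\<^sup>+x. ennreal (exp (- P * x\<^sup>2 - 2 * x * d)) \<partial>density lborel (normal_density 0 (sqrt (1/2))))
    = ennreal (exp (d\<^sup>2 / (1 + P)) / sqrt (1 + P))"
proof -
  define q where "q = 1 + P"
  have q: "q > 0" using assms by (simp add: q_def)
  define c where "c = exp (d\<^sup>2 / q) / sqrt q"
  define \<sigma> where "\<sigma> = sqrt (1 / (2 * q))"
  have \<sigma>: "\<sigma> > 0" "\<sigma>\<^sup>2 = 1 / (2 * q)" using q by (auto simp: \<sigma>_def)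
  have *: "normal_density 0 (sqrt (1/2)) x * exp (- P * x\<^sup>2 - 2 * x * d) = c * normal_density (- d / q) \<sigma> x" for x
  proof -
    have e: "- x\<^sup>2 + (- P * x\<^sup>2 - 2 * x * d) = d\<^sup>2 / q - q * (x - (- d / q))\<^sup>2"
    proof -
      have "q * (x - (- d / q))\<^sup>2 = q * x\<^sup>2 + 2 * x * d + d\<^sup>2 / q"
        using q by (simp add: power2_eq_square field_simps)
      then show ?thesis by (simp add: q_def algebra_simps)
    qed
    have "normal_density 0 (sqrt (1/2)) x * exp (- P * x\<^sup>2 - 2 * x * d)
        = 1 / sqrt pi * exp (- x\<^sup>2 + (- P * x\<^sup>2 - 2 * x * d))"
      by (simp add: normal_density_def mult_exp_exp)
    also have "\<dots> = 1 / sqrt pi * (exp (d\<^sup>2 / q) * exp (- (q * (x - (- d / q))\<^sup>2)))"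
      unfolding e by (simp flip: exp_add)
    also have "\<dots> = c * normal_density (- d / q) \<sigma> x"
      using q by (simp add: normal_density_def \<sigma> c_def real_sqrt_divide mult.commute)
    finally show ?thesis .
  qed
  have "0 \<le> c" using q by (simp add: c_def)
  have "(\<integral>\<^sup>+x. ennreal (exp (- P * x\<^sup>2 - 2 * x * d)) \<partial>density lborel (normal_density 0 (sqrt (1/2))))
      = (\<integral>\<^sup>+x. ennreal (c * normal_density (- d / q) \<sigma> x) \<partial>lborel)"
    by (subst nn_integral_density) (auto intro!: nn_integral_cong simp: *[simplified] simp flip: ennreal_mult)
  also have "\<dots> = ennreal c * ennreal (\<integral>x. normal_density (- d / q) \<sigma> x \<partial>lborel)"
    using \<sigma> \<open>0 \<le> c\<close> by (subst nn_integral_eq_integral[symmetric]) (auto simp: ennreal_mult nn_integral_cmult)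
  finally show ?thesis using \<sigma> by (simp add: c_def q_def)
qed

lemma nn_integral_complex_gaussian_exp_quadratic:
  fixes P :: real and d :: complex
  assumes P: "1 + P > 0"
  shows "(\<integral>\<^sup>+g. ennreal (exp (- P * (cmod g)\<^sup>2 - 2 * (g \<bullet> d))) \<partial>complex_gaussian)
    = ennreal (exp ((cmod d)\<^sup>2 / (1 + P)) / (1 + P))"
proof -
  let ?N = "density lborel (normal_density 0 (sqrt (1/2)))"
  interpret N: prob_space ?N by (rule prob_space_normal_density) simp
  have s: "sets (?N \<Otimes>\<^sub>M ?N) = sets (borel \<Otimes>\<^sub>M borel)" by (intro sets_pair_measure_cong) auto
  have "(\<integral>\<^sup>+g. ennreal (exp (- P * (cmod g)\<^sup>2 - 2 * (g \<bullet> d))) \<partial>complex_gaussian)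
      = (\<integral>\<^sup>+p. ennreal (exp (- P * (fst p)\<^sup>2 - 2 * fst p * Re d)) * ennreal (exp (- P * (snd p)\<^sup>2 - 2 * snd p * Im d)) \<partial>(?N \<Otimes>\<^sub>M ?N))"
    unfolding complex_gaussian_def Let_def
    by (subst nn_integral_distr)
      (auto simp: s cong: measurable_cong_sets intro!: nn_integral_cong
        simp: inner_complex_def cmod_power2 algebra_simps simp flip: ennreal_mult exp_add)
  also have "\<dots> = (\<integral>\<^sup>+x. \<integral>\<^sup>+y. ennreal (exp (- P * x\<^sup>2 - 2 * x * Re d)) * ennreal (exp (- P * y\<^sup>2 - 2 * y * Im d)) \<partial>?N \<partial>?N)"
    by (subst N.nn_integral_fst[symmetric]) auto
  also have "\<dots> = ennreal (exp ((Re d)\<^sup>2 / (1 + P)) / sqrt (1 + P)) * ennreal (exp ((Im d)\<^sup>2 / (1 + P)) / sqrt (1 + P))"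
    using nn_integral_normal_exp_quadratic[OF P]
    by (simp add: nn_integral_cmult nn_integral_multc)
  also have "\<dots> = ennreal (exp ((cmod d)\<^sup>2 / (1 + P)) / (1 + P))"
    using P by (simp add: cmod_power2 add_divide_distrib exp_add flip: ennreal_mult)
  finally show ?thesis .
qed

subsection \<open>The joint Laplace transform of two linear functionals\<close>

lemma cdot_cnj: "cnj (cdot x y) = cdot y x"
  by (simp add: cdot_def mult.commute)

lemma norm_sq_eq_cdot: "complex_of_real ((norm x)\<^sup>2) = cdot x x"
proof -
  have "cdot x x = complex_of_real (\<Sum>i\<in>UNIV. (cmod (x $ i))\<^sup>2)"
    unfolding cdot_def of_real_sum by (intro sum.cong refl) (simp add: complex_norm_square mult.commute del: of_real_power)
  then show ?thesis by (simp add: norm_vec_sq)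
qed

lemma norm_vector_scalar_mult: "norm (c *s (x :: complex ^ 'k)) = cmod c * norm x"
proof -
  have "(norm (c *s x))\<^sup>2 = (cmod c * norm x)\<^sup>2"
    by (simp add: norm_vec_sq norm_mult power_mult_distrib sum_distrib_left)
  then show ?thesis by (simp add: power2_eq_iff_nonneg)
qed

lemma cdot_Cauchy_Schwarz: "(cmod (cdot p q))\<^sup>2 \<le> (norm p)\<^sup>2 * (norm q)\<^sup>2"
proof -
  define c where "c = cdot p q"
  have "(cmod c)\<^sup>2 = Re (cnj c * c)" unfolding cmod_power2 by (simp add: power2_eq_square)
  also have "\<dots> = (c *s p) \<bullet> q" by (simp add: inner_eq_Re_cdot cdot_scale_left c_def)
  also have "\<dots> \<le> norm (c *s p) * norm q" by (rule norm_cauchy_schwarz)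
  finally have "cmod c * cmod c \<le> cmod c * (norm p * norm q)"
    by (simp add: norm_vector_scalar_mult power2_eq_square mult.assoc)
  then have "cmod c \<le> norm p * norm q"
    by (cases "c = 0") (auto simp: mult_le_cancel_left)
  then show ?thesis
    unfolding c_def[symmetric] by (metis norm_ge_zero power_mono power_mult_distrib)
qed

lemma norm_sq_add_scaled:
  "(norm (a *s p + b *s q))\<^sup>2
    = (cmod a)\<^sup>2 * (norm p)\<^sup>2 + (cmod b)\<^sup>2 * (norm q)\<^sup>2 + 2 * (a \<bullet> (b * cdot p q))"
proof -
  have "(norm (a *s p + b *s q))\<^sup>2 = (norm (a *s p))\<^sup>2 + (norm (b *s q))\<^sup>2 + 2 * ((a *s p) \<bullet> (b *s q))"
    unfolding power2_norm_eq_inner by (simp add: inner_add_left inner_add_right inner_commute)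
  moreover have "(a *s p) \<bullet> (b *s q) = a \<bullet> (b * cdot p q)"
    by (simp add: inner_eq_Re_cdot cdot_scale_left cdot_scale_right inner_complex_def algebra_simps)
  ultimately show ?thesis
    by (simp add: norm_vector_scalar_mult power_mult_distrib)
qed

text \<open>The joint Laplace transform: writing each Gaussian factor \<open>exp (-|z|\<^sup>2)\<close> as a
  characteristic function of an auxiliary Gaussian reduces it to the characteristic function of \<open>u\<close>.\<close>

lemma (in prob_space) Laplace_cdot_pair:
  assumes u: "std_complex_normal_vec M u"
  shows "expectation (\<lambda>\<omega>. exp (- (cmod (cdot p (u \<omega>)))\<^sup>2 - (cmod (cdot q (u \<omega>)))\<^sup>2))
    = 1 / ((1 + (norm p)\<^sup>2) * (1 + (norm q)\<^sup>2) - (cmod (cdot p q))\<^sup>2)"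
proof -
  note [measurable] = std_complex_normal_vec_measurable[OF prob_space_axioms u]
  let ?\<gamma> = complex_gaussian
  interpret G: prob_space ?\<gamma> by (rule prob_space_complex_gaussian)
  interpret GG: pair_prob_space ?\<gamma> ?\<gamma> ..
  interpret MG: pair_prob_space M "?\<gamma> \<Otimes>\<^sub>M ?\<gamma>" ..
  define P Q C where "P = (norm p)\<^sup>2" and "Q = (norm q)\<^sup>2" and "C = (cmod (cdot p q))\<^sup>2"
  have P: "0 \<le> P" and Q: "0 \<le> Q" and C: "C \<le> P * Q"
    using cdot_Cauchy_Schwarz by (auto simp: P_def Q_def C_def)
  \<comment> \<open>After \<open>a\<close> is integrated out, Q - C / (1 + P) is the coefficient of
    |b|^2, a Schur complement; Cauchy-Schwarz keeps it nonnegative, so the second Gaussian integral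
    converges.\<close>
  have Q': "0 \<le> Q - C / (1 + P)"
  proof -
    have "C / (1 + P) \<le> P * Q / (1 + P)" using C P by (intro divide_right_mono) auto
    also have "\<dots> \<le> Q" using P Q by (simp add: divide_le_eq algebra_simps)
    finally show ?thesis by simp
  qed
  define E where "E = expectation (\<lambda>\<omega>. exp (- (cmod (cdot p (u \<omega>)))\<^sup>2 - (cmod (cdot q (u \<omega>)))\<^sup>2))"
  define K where "K g = exp (- (norm (fst g *s p + snd g *s q))\<^sup>2)" for g :: "complex \<times> complex"
  have K: "K (a, b) = exp (- P * (cmod a)\<^sup>2 - 2 * (a \<bullet> (b * cdot p q))) * exp (- Q * (cmod b)\<^sup>2)" for a b
    by (simp add: K_def norm_sq_add_scaled P_def Q_def mult_exp_exp algebra_simps)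
  have [measurable]: "K \<in> borel_measurable (?\<gamma> \<Otimes>\<^sub>M ?\<gamma>)"
    unfolding K_def[abs_def] norm_sq_add_scaled by measurable
  have phase: "2 * (a \<bullet> cdot p (u \<omega>)) + 2 * (b \<bullet> cdot q (u \<omega>)) = (2 *\<^sub>R (a *s p + b *s q)) \<bullet> u \<omega>" for a b \<omega>
    by (simp add: inner_add_left inner_eq_Re_cdot[of "_ *s _"] cdot_scale_left)
      (simp add: inner_complex_def)
  have "complex_of_real E = expectation (\<lambda>\<omega>. complex_of_real (exp (- (cmod (cdot p (u \<omega>)))\<^sup>2))
      * complex_of_real (exp (- (cmod (cdot q (u \<omega>)))\<^sup>2)))"
    unfolding E_def integral_complex_of_real[symmetric]
    by (intro Bochner_Integration.integral_cong refl) (simp flip: exp_add of_real_mult)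
  also have "\<dots> = expectation (\<lambda>\<omega>. \<integral>a. \<integral>b. cis (2 * (a \<bullet> cdot p (u \<omega>))) * cis (2 * (b \<bullet> cdot q (u \<omega>))) \<partial>?\<gamma> \<partial>?\<gamma>)"
    unfolding exp_neg_cmod_sq_eq_integral by simp
  also have "\<dots> = expectation (\<lambda>\<omega>. \<integral>g. cis ((2 *\<^sub>R (fst g *s p + snd g *s q)) \<bullet> u \<omega>) \<partial>(?\<gamma> \<Otimes>\<^sub>M ?\<gamma>))"
    unfolding phase[symmetric] cis_mult
    by (intro Bochner_Integration.integral_cong refl, subst GG.integral_fst'[symmetric])
      (auto intro!: GG.P.integrable_cis)
  also have "\<dots> = (\<integral>g. expectation (\<lambda>\<omega>. cis ((2 *\<^sub>R (fst g *s p + snd g *s q)) \<bullet> u \<omega>)) \<partial>(?\<gamma> \<Otimes>\<^sub>M ?\<gamma>))"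
    unfolding phase[symmetric]
    unfolding case_prod_beta
    by (rule MG.Fubini_integral[symmetric], unfold case_prod_beta, rule MG.P.integrable_cis) measurable
  also have "\<dots> = (\<integral>g. complex_of_real (K g) \<partial>(?\<gamma> \<Otimes>\<^sub>M ?\<gamma>))"
    unfolding expectation_cis_std_complex_normal_vec[OF u] K_def by simp
  finally have E: "E = (\<integral>g. K g \<partial>(?\<gamma> \<Otimes>\<^sub>M ?\<gamma>))"
    by simp
  \<comment> \<open>From here on the integrand \<open>K\<close> is positive, and iterated
    integration in either order needs only measurability. The exchange with the expectation above
    rested on phases being bounded.\<close>
  have "ennreal E = (\<integral>\<^sup>+g. ennreal (K g) \<partial>(?\<gamma> \<Otimes>\<^sub>M ?\<gamma>))"
    unfolding E
    by (rule nn_integral_eq_integral[symmetric])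
      (auto intro!: GG.P.integrable_const_bound[where B = 1] simp: K_def)
  also have "\<dots> = (\<integral>\<^sup>+b. \<integral>\<^sup>+a. ennreal (K (a, b)) \<partial>?\<gamma> \<partial>?\<gamma>)"
    by (subst GG.nn_integral_snd[symmetric]) auto
  also have "\<dots> = (\<integral>\<^sup>+b. ennreal (1 / (1 + P)) * ennreal (exp (- (Q - C / (1 + P)) * (cmod b)\<^sup>2 - 2 * (b \<bullet> 0))) \<partial>?\<gamma>)"
  proof (rule nn_integral_cong)
    fix b
    have "(\<integral>\<^sup>+a. ennreal (K (a, b)) \<partial>?\<gamma>) = ennreal (exp ((cmod (b * cdot p q))\<^sup>2 / (1 + P)) / (1 + P)) * ennreal (exp (- Q * (cmod b)\<^sup>2))"
      using P by (simp add: K ennreal_mult nn_integral_multc nn_integral_complex_gaussian_exp_quadratic[simplified])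
    also have "\<dots> = ennreal (1 / (1 + P)) * ennreal (exp (- (Q - C / (1 + P)) * (cmod b)\<^sup>2 - 2 * (b \<bullet> 0)))"
      using P by (simp add: norm_mult power_mult_distrib C_def mult_exp_exp algebra_simps flip: ennreal_mult)
    finally show "(\<integral>\<^sup>+a. ennreal (K (a, b)) \<partial>?\<gamma>) = \<dots>" .
  qed
  also have "\<dots> = ennreal (1 / (1 + P)) * ennreal (1 / (1 + (Q - C / (1 + P))))"
  proof -
    have "(\<integral>\<^sup>+b. ennreal (exp (- (Q - C / (1 + P)) * (cmod b)\<^sup>2 - 2 * (b \<bullet> 0))) \<partial>?\<gamma>)
        = ennreal (exp ((cmod 0)\<^sup>2 / (1 + (Q - C / (1 + P)))) / (1 + (Q - C / (1 + P))))"
      using Q' by (intro nn_integral_complex_gaussian_exp_quadratic) auto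
    also have "exp ((cmod 0)\<^sup>2 / (1 + (Q - C / (1 + P)))) = 1" by simp
    finally have h: "(\<integral>\<^sup>+b. ennreal (exp (- (Q - C / (1 + P)) * (cmod b)\<^sup>2 - 2 * (b \<bullet> 0))) \<partial>?\<gamma>)
        = ennreal (1 / (1 + (Q - C / (1 + P))))" .
    show ?thesis unfolding h[symmetric] by (rule nn_integral_cmult) measurable
  qed
  also have "\<dots> = ennreal (1 / ((1 + P) * (1 + (Q - C / (1 + P)))))"
    using P by (subst ennreal_mult'[symmetric]) auto
  also have "(1 + P) * (1 + (Q - C / (1 + P))) = (1 + P) * (1 + Q) - C"
    using P by (simp add: field_simps)
  finally have "ennreal E = ennreal (1 / ((1 + P) * (1 + Q) - C))" .
  moreover have "0 \<le> E" unfolding E_def by (intro integral_nonneg_AE) auto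
  moreover have "0 \<le> 1 / ((1 + P) * (1 + Q) - C)"
    using P Q C by (simp add: algebra_simps)
  ultimately have "E = 1 / ((1 + P) * (1 + Q) - C)"
    by (subst (asm) ennreal_inj)
  then show ?thesis unfolding E_def P_def Q_def C_def .
qed

text \<open>The function \<open>E (1 - exp (-\<sigma> |z|\<^sup>2)) (1 - exp (-\<tau> |w|\<^sup>2))\<close>, with the leading product
  \<open>\<sigma>\<tau>\<close> factored out; here \<open>P = E |z|\<^sup>2\<close>, \<open>Q = E |w|\<^sup>2\<close> and \<open>C = |E z* w|\<^sup>2\<close>.\<close>

definition pair_kernel :: "real \<Rightarrow> real \<Rightarrow> real \<Rightarrow> real \<Rightarrow> real \<Rightarrow> real" where
  "pair_kernel P Q C \<sigma> \<tau> =
     (let D = (1 + \<sigma> * P) * (1 + \<tau> * Q) in P * Q / D + C / (D * (D - \<sigma> * \<tau> * C)))"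

text \<open>Expanding the product gives the joint transform at the four corners (0,0), (\<sigma>,0),
  (0,\<tau>) and (\<sigma>,\<tau>). The parameters enter by scaling p and q by square roots, and
  Cauchy-Schwarz keeps the last denominator positive.\<close>

lemma (in prob_space) nn_integral_cdot_pair:
  assumes u: "std_complex_normal_vec M u" and "0 \<le> \<sigma>" "0 \<le> \<tau>"
  shows "(\<integral>\<^sup>+\<omega>. ennreal ((1 - exp (- \<sigma> * (cmod (cdot p (u \<omega>)))\<^sup>2)) * (1 - exp (- \<tau> * (cmod (cdot q (u \<omega>)))\<^sup>2))) \<partial>M)
    = ennreal (\<sigma> * \<tau> * pair_kernel ((norm p)\<^sup>2) ((norm q)\<^sup>2) ((cmod (cdot p q))\<^sup>2) \<sigma> \<tau>)"
proof -
  note [measurable] = std_complex_normal_vec_measurable[OF prob_space_axioms u]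
  define P Q C where "P = (norm p)\<^sup>2" and "Q = (norm q)\<^sup>2" and "C = (cmod (cdot p q))\<^sup>2"
  have P: "0 \<le> P" and Q: "0 \<le> Q" and C: "C \<le> P * Q" "0 \<le> C"
    using cdot_Cauchy_Schwarz by (auto simp: P_def Q_def C_def)
  have L: "expectation (\<lambda>\<omega>. exp (- s * (cmod (cdot p (u \<omega>)))\<^sup>2 - t * (cmod (cdot q (u \<omega>)))\<^sup>2))
      = 1 / ((1 + s * P) * (1 + t * Q) - s * t * C)" if "0 \<le> s" "0 \<le> t" for s t
    using Laplace_cdot_pair[OF u, of "complex_of_real (sqrt s) *s p" "complex_of_real (sqrt t) *s q"] that
    by (simp add: cdot_scale_left cdot_scale_right norm_mult norm_vector_scalar_mult power_mult_distrib
        P_def Q_def C_def mult_ac)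
  have int: "integrable M (\<lambda>\<omega>. exp (- s * (cmod (cdot p (u \<omega>)))\<^sup>2 - t * (cmod (cdot q (u \<omega>)))\<^sup>2))"
    if "0 \<le> s" "0 \<le> t" for s t
  proof (rule integrable_const_bound[where B = 1])
    have "- s * x\<^sup>2 - t * y\<^sup>2 \<le> 0" for x y :: real
      using mult_nonneg_nonneg[OF that(1), of "x\<^sup>2"] mult_nonneg_nonneg[OF that(2), of "y\<^sup>2"] by simp
    then show "AE \<omega> in M. norm (exp (- s * (cmod (cdot p (u \<omega>)))\<^sup>2 - t * (cmod (cdot q (u \<omega>)))\<^sup>2)) \<le> 1"
      by (intro AE_I2) (simp only: real_norm_def abs_exp_cancel exp_le_one_iff)
  qed measurable
  define D where "D = (1 + \<sigma> * P) * (1 + \<tau> * Q)"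
  have D: "D > 0" "D - \<sigma> * \<tau> * C > 0"
  proof -
    show "D > 0" using assms P Q by (simp add: D_def add_pos_nonneg)
    have "\<sigma> * \<tau> * C \<le> \<sigma> * \<tau> * (P * Q)" using assms C by (intro mult_left_mono) auto
    also have "\<dots> < D" using assms P Q by (simp add: D_def algebra_simps add_pos_nonneg)
    finally show "D - \<sigma> * \<tau> * C > 0" by simp
  qed
  let ?f = "\<lambda>s t \<omega>. exp (- s * (cmod (cdot p (u \<omega>)))\<^sup>2 - t * (cmod (cdot q (u \<omega>)))\<^sup>2)"
  have eq: "(1 - exp (- \<sigma> * (cmod (cdot p (u \<omega>)))\<^sup>2)) * (1 - exp (- \<tau> * (cmod (cdot q (u \<omega>)))\<^sup>2))
      = ?f 0 0 \<omega> - ?f \<sigma> 0 \<omega> - ?f 0 \<tau> \<omega> + ?f \<sigma> \<tau> \<omega>" for \<omega>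
    by (simp add: algebra_simps mult_exp_exp)
  have "(\<integral>\<^sup>+\<omega>. ennreal ((1 - exp (- \<sigma> * (cmod (cdot p (u \<omega>)))\<^sup>2)) * (1 - exp (- \<tau> * (cmod (cdot q (u \<omega>)))\<^sup>2))) \<partial>M)
      = ennreal (expectation (\<lambda>\<omega>. ?f 0 0 \<omega> - ?f \<sigma> 0 \<omega> - ?f 0 \<tau> \<omega> + ?f \<sigma> \<tau> \<omega>))"
  proof -
    have "integrable M (\<lambda>\<omega>. ?f 0 0 \<omega> - ?f \<sigma> 0 \<omega> - ?f 0 \<tau> \<omega> + ?f \<sigma> \<tau> \<omega>)"
      by (intro Bochner_Integration.integrable_add Bochner_Integration.integrable_diff int assms order_refl)
    moreover have "0 \<le> ?f 0 0 \<omega> - ?f \<sigma> 0 \<omega> - ?f 0 \<tau> \<omega> + ?f \<sigma> \<tau> \<omega>" for \<omega>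
      unfolding eq[symmetric] using assms by simp
    ultimately show ?thesis
      unfolding eq by (intro nn_integral_eq_integral) auto
  qed
  also have "expectation (\<lambda>\<omega>. ?f 0 0 \<omega> - ?f \<sigma> 0 \<omega> - ?f 0 \<tau> \<omega> + ?f \<sigma> \<tau> \<omega>)
      = 1 - 1 / (1 + \<sigma> * P) - 1 / (1 + \<tau> * Q) + 1 / (D - \<sigma> * \<tau> * C)"
    using L[of 0 0] L[of \<sigma> 0] L[of 0 \<tau>] L[of \<sigma> \<tau>] int[of 0 0] int[of \<sigma> 0] int[of 0 \<tau>] int[of \<sigma> \<tau>] assms
    by (simp add: D_def prob_space)
  also have "\<dots> = \<sigma> * \<tau> * pair_kernel P Q C \<sigma> \<tau>"
  proof -
    have nz: "1 + \<sigma> * P \<noteq> 0" "1 + \<tau> * Q \<noteq> 0" using assms P Q by (auto simp: add_nonneg_eq_0_iff)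
    have "1 - 1 / (1 + \<sigma> * P) - 1 / (1 + \<tau> * Q) + 1 / D = \<sigma> * \<tau> * (P * Q / D)"
      unfolding D_def using nz by (simp add: divide_simps) (simp add: algebra_simps)
    moreover have "1 / (D - \<sigma> * \<tau> * C) - 1 / D = \<sigma> * \<tau> * (C / (D * (D - \<sigma> * \<tau> * C)))"
      using D by (simp add: divide_simps)
    moreover have "\<sigma> * \<tau> * pair_kernel P Q C \<sigma> \<tau>
        = \<sigma> * \<tau> * (P * Q / D) + \<sigma> * \<tau> * (C / (D * (D - \<sigma> * \<tau> * C)))"
      unfolding pair_kernel_def Let_def D_def by (rule distrib_left)
    ultimately show ?thesis by linarith
  qed
  finally show ?thesis by (simp only: P_def Q_def C_def)
qed

subsection \<open>Mixed moments of two linear functionals\<close>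

text \<open>Halving the exponent replaces e^2 by e, and 1 - e^2 = (1 - e)(1 + e) is at most 2 (1 -
  e). Dyadic steps therefore approximate x from below monotonically, which is what monotone
  convergence asks for.\<close>

lemma incseq_one_minus_exp:
  fixes x :: real
  assumes "0 \<le> x"
  shows "incseq (\<lambda>k. 2 ^ k * (1 - exp (- (1 / 2 ^ k) * x)))"
proof (rule incseq_SucI)
  fix k :: nat
  define e where "e = exp (- (1 / 2 ^ Suc k) * x)"
  have e: "e \<le> 1" using assms by (simp add: e_def)
  have "exp (- (1 / 2 ^ k) * x) = e * e" by (simp add: e_def flip: exp_add)
  then have "2 ^ k * (1 - exp (- (1 / 2 ^ k) * x)) = 2 ^ k * ((1 - e) * (1 + e))" by (simp add: algebra_simps)
  also have "\<dots> \<le> 2 ^ k * ((1 - e) * 2)" using e by (intro mult_left_mono) auto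
  finally show "2 ^ k * (1 - exp (- (1 / 2 ^ k) * x)) \<le> 2 ^ Suc k * (1 - exp (- (1 / 2 ^ Suc k) * x))"
    by (simp add: e_def)
qed

lemma tendsto_one_minus_exp: "(\<lambda>k::nat. 2 ^ k * (1 - exp (- (1 / 2 ^ k) * x))) \<longlonglongrightarrow> (x::real)"
proof -
  have "((\<lambda>h. exp (- x * h)) has_real_derivative - x) (at 0)"
    by (auto intro!: derivative_eq_intros)
  then have "((\<lambda>h. (exp (- x * h) - 1) / h) \<longlongrightarrow> - x) (at 0)"
    by (simp add: DERIV_def)
  moreover have "filterlim (\<lambda>k::nat. 1 / 2 ^ k :: real) (at 0) sequentially"
    by real_asymp
  ultimately have "(\<lambda>k::nat. (exp (- x * (1 / 2 ^ k)) - 1) / (1 / 2 ^ k)) \<longlonglongrightarrow> - x"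
    by (rule filterlim_compose)
  from tendsto_minus[OF this] show ?thesis
    by (simp add: algebra_simps)
qed

lemma pair_kernel_0_left: "pair_kernel P Q C 0 \<tau> = P * Q / (1 + \<tau> * Q) + C / (1 + \<tau> * Q)\<^sup>2"
  by (simp add: pair_kernel_def Let_def power2_eq_square)

lemma tendsto_pair_kernel:
  assumes "(f \<longlongrightarrow> 0) F" "(g \<longlongrightarrow> t) F" "0 \<le> t" "0 \<le> Q"
  shows "((\<lambda>x. pair_kernel P Q C (f x) (g x)) \<longlongrightarrow> pair_kernel P Q C 0 t) F"
proof -
  have "1 + t * Q \<noteq> 0" using assms(3,4) by (simp add: add_nonneg_eq_0_iff)
  then show ?thesis
    unfolding pair_kernel_def Let_def by (intro tendsto_intros assms(1,2)) auto
qed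

text \<open>Only the first parameter is sent to 0: with \<sigma> = 1 / 2^k the factor \<sigma>
  cancels the scaling, and \<open>pair_kernel\<close> is continuous there. Keeping \<tau> free
  serves two purposes: a second limit gives E |z|^2 |w|^2, and integrating over \<tau> = s^2 gives E
  |z|^2 |w|.\<close>

lemma (in prob_space) nn_integral_cmod_sq_one_minus_exp:
  assumes u: "std_complex_normal_vec M u" and \<tau>: "0 \<le> \<tau>"
  shows "(\<integral>\<^sup>+\<omega>. ennreal ((cmod (cdot p (u \<omega>)))\<^sup>2 * (1 - exp (- \<tau> * (cmod (cdot q (u \<omega>)))\<^sup>2))) \<partial>M)
    = ennreal (\<tau> * ((norm p)\<^sup>2 * (norm q)\<^sup>2 / (1 + \<tau> * (norm q)\<^sup>2)
        + (cmod (cdot p q))\<^sup>2 / (1 + \<tau> * (norm q)\<^sup>2)\<^sup>2))"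
proof -
  note [measurable] = std_complex_normal_vec_measurable[OF prob_space_axioms u]
  let ?a = "\<lambda>\<omega>. (cmod (cdot p (u \<omega>)))\<^sup>2" and ?b = "\<lambda>\<omega>. 1 - exp (- \<tau> * (cmod (cdot q (u \<omega>)))\<^sup>2)"
  let ?K = "pair_kernel ((norm p)\<^sup>2) ((norm q)\<^sup>2) ((cmod (cdot p q))\<^sup>2)"
  define f where "f k \<omega> = ennreal (2 ^ k * (1 - exp (- (1 / 2 ^ k) * ?a \<omega>)) * ?b \<omega>)" for k :: nat and \<omega>
  have b: "0 \<le> ?b \<omega>" for \<omega> using \<tau> by simp
  have lim: "(\<lambda>k. integral\<^sup>N M (f k)) \<longlonglongrightarrow> (\<integral>\<^sup>+\<omega>. ennreal (?a \<omega> * ?b \<omega>) \<partial>M)"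
  proof (rule nn_integral_LIMSEQ)
    show "incseq f"
      using incseqD[OF incseq_one_minus_exp] b
      by (auto simp: f_def intro!: monoI le_funI ennreal_leI mult_right_mono)
    show "(\<lambda>k. f k \<omega>) \<longlonglongrightarrow> ennreal (?a \<omega> * ?b \<omega>)" for \<omega>
      unfolding f_def by (intro tendsto_ennrealI tendsto_mult tendsto_one_minus_exp tendsto_const)
    show "f k \<in> borel_measurable M" for k unfolding f_def by measurable
  qed
  have fk: "integral\<^sup>N M (f k) = ennreal (\<tau> * ?K (1 / 2 ^ k) \<tau>)" for k
  proof -
    have "integral\<^sup>N M (f k) = ennreal (2 ^ k) * (\<integral>\<^sup>+\<omega>. ennreal ((1 - exp (- (1 / 2 ^ k) * ?a \<omega>)) * ?b \<omega>) \<partial>M)"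
      unfolding f_def
      by (subst nn_integral_cmult[symmetric]) (auto simp: ennreal_mult' mult.assoc)
    also have "\<dots> = ennreal (2 ^ k * (1 / 2 ^ k * \<tau> * ?K (1 / 2 ^ k) \<tau>))"
      using \<tau> by (subst nn_integral_cdot_pair[OF u]) (auto simp flip: ennreal_mult')
    finally show ?thesis by simp
  qed
  have "(\<lambda>k::nat. ennreal (\<tau> * ?K (1 / 2 ^ k) \<tau>)) \<longlonglongrightarrow> ennreal (\<tau> * ?K 0 \<tau>)"
    using \<tau> by (intro tendsto_ennrealI tendsto_mult tendsto_const tendsto_pair_kernel) (auto, real_asymp)
  from LIMSEQ_unique[OF lim[unfolded fk] this] show ?thesis
    by (simp only: pair_kernel_0_left)
qed

text \<open>Wick's formula E |z|^2 |w|^2 = E |z|^2 E |w|^2 + |E z* w|^2, from the second limit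
  \<tau> to 0.\<close>

lemma (in prob_space) cmod_sq_cmod_sq:
  assumes u: "std_complex_normal_vec M u"
  shows "has_bochner_integral M (\<lambda>\<omega>. (cmod (cdot p (u \<omega>)))\<^sup>2 * (cmod (cdot q (u \<omega>)))\<^sup>2)
    ((norm p)\<^sup>2 * (norm q)\<^sup>2 + (cmod (cdot p q))\<^sup>2)"
proof -
  note [measurable] = std_complex_normal_vec_measurable[OF prob_space_axioms u]
  let ?a = "\<lambda>\<omega>. (cmod (cdot p (u \<omega>)))\<^sup>2" and ?b = "\<lambda>\<omega>. (cmod (cdot q (u \<omega>)))\<^sup>2"
  define h where "h \<tau> = (norm p)\<^sup>2 * (norm q)\<^sup>2 / (1 + \<tau> * (norm q)\<^sup>2)
        + (cmod (cdot p q))\<^sup>2 / (1 + \<tau> * (norm q)\<^sup>2)\<^sup>2" for \<tau>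
  define f where "f k \<omega> = ennreal (?a \<omega> * (2 ^ k * (1 - exp (- (1 / 2 ^ k) * ?b \<omega>))))" for k :: nat and \<omega>
  have lim: "(\<lambda>k. integral\<^sup>N M (f k)) \<longlonglongrightarrow> (\<integral>\<^sup>+\<omega>. ennreal (?a \<omega> * ?b \<omega>) \<partial>M)"
  proof (rule nn_integral_LIMSEQ)
    show "incseq f"
      using incseqD[OF incseq_one_minus_exp]
      by (auto simp: f_def intro!: monoI le_funI ennreal_leI mult_left_mono)
    show "(\<lambda>k. f k \<omega>) \<longlonglongrightarrow> ennreal (?a \<omega> * ?b \<omega>)" for \<omega>
      unfolding f_def by (intro tendsto_ennrealI tendsto_mult tendsto_one_minus_exp tendsto_const)
    show "f k \<in> borel_measurable M" for k unfolding f_def by measurable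
  qed
  have fk: "integral\<^sup>N M (f k) = ennreal (h (1 / 2 ^ k))" for k
  proof -
    have "integral\<^sup>N M (f k) = ennreal (2 ^ k) * (\<integral>\<^sup>+\<omega>. ennreal (?a \<omega> * (1 - exp (- (1 / 2 ^ k) * ?b \<omega>))) \<partial>M)"
      unfolding f_def
      by (subst nn_integral_cmult[symmetric]) (auto simp: mult.left_commute simp flip: ennreal_mult')
    also have "\<dots> = ennreal (2 ^ k * (1 / 2 ^ k * h (1 / 2 ^ k)))"
      by (subst nn_integral_cmod_sq_one_minus_exp[OF u]) (auto simp: h_def simp flip: ennreal_mult')
    finally show ?thesis by simp
  qed
  have "(\<lambda>k::nat. ennreal (h (1 / 2 ^ k))) \<longlonglongrightarrow> ennreal (h 0)"
  proof -
    have "(\<lambda>k::nat. 1 / 2 ^ k :: real) \<longlonglongrightarrow> 0" by real_asymp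
    then have "(\<lambda>k::nat. h (1 / 2 ^ k)) \<longlonglongrightarrow> (norm p)\<^sup>2 * (norm q)\<^sup>2 / (1 + 0 * (norm q)\<^sup>2)
        + (cmod (cdot p q))\<^sup>2 / (1 + 0 * (norm q)\<^sup>2)\<^sup>2"
      unfolding h_def by (intro tendsto_intros) auto
    then show ?thesis by (intro tendsto_ennrealI) (simp add: h_def)
  qed
  from LIMSEQ_unique[OF lim[unfolded fk] this]
  have "(\<integral>\<^sup>+\<omega>. ennreal (?a \<omega> * ?b \<omega>) \<partial>M) = ennreal (h 0)" .
  then show ?thesis
    by (intro has_bochner_integral_nn_integral) (auto simp: h_def)
qed

text \<open>The weight \<open>W\<close> is an arbitrary nonnegative extended function, so it may
  hold a squared modulus, a second modulus, or the kernel of an earlier application; two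
  applications turn E |z| |w| into a double integral.\<close>

lemma (in prob_space) nn_integral_Bernstein:
  assumes [measurable]: "Z \<in> borel_measurable M" "W \<in> borel_measurable M" and "\<And>\<omega>. 0 \<le> Z \<omega>"
  shows "(\<integral>\<^sup>+\<omega>. W \<omega> * ennreal (2 * sqrt pi * Z \<omega>) \<partial>M)
    = (\<integral>\<^sup>+s. \<integral>\<^sup>+\<omega>. W \<omega> * ennreal ((1 - exp (- s\<^sup>2 * (Z \<omega>)\<^sup>2)) / s\<^sup>2) \<partial>M \<partial>lborel)"
proof -
  interpret pair_sigma_finite M lborel ..
  have "(\<integral>\<^sup>+\<omega>. W \<omega> * ennreal (2 * sqrt pi * Z \<omega>) \<partial>M)
      = (\<integral>\<^sup>+\<omega>. \<integral>\<^sup>+s. W \<omega> * ennreal ((1 - exp (- s\<^sup>2 * (Z \<omega>)\<^sup>2)) / s\<^sup>2) \<partial>lborel \<partial>M)"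
    by (simp add: nn_integral_cmult power_mult_distrib assms(3) flip: nn_integral_Bernstein_kernel)
  also have "\<dots> = (\<integral>\<^sup>+s. \<integral>\<^sup>+\<omega>. W \<omega> * ennreal ((1 - exp (- s\<^sup>2 * (Z \<omega>)\<^sup>2)) / s\<^sup>2) \<partial>M \<partial>lborel)"
    by (rule Fubini'[symmetric]) measurable
  finally show ?thesis .
qed

lemma AE_lborel_nonzero: "AE s in lborel. s \<noteq> (0::real)"
  by (rule AE_lborel_singleton)

lemma (in prob_space) has_bochner_integral_of_nn_integral_scaled:
  assumes [measurable]: "f \<in> borel_measurable M" and "\<And>\<omega>. 0 \<le> f \<omega>" "0 < c" "0 \<le> x"
    and "(\<integral>\<^sup>+\<omega>. ennreal (c * f \<omega>) \<partial>M) = ennreal x"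
  shows "has_bochner_integral M f (x / c)"
proof -
  have "has_bochner_integral M (\<lambda>\<omega>. c * f \<omega>) x"
    using assms by (intro has_bochner_integral_nn_integral) auto
  then have "has_bochner_integral M (\<lambda>\<omega>. (1 / c) * (c * f \<omega>)) ((1 / c) * x)"
    by (rule has_bochner_integral_mult_right)
  then show ?thesis using \<open>0 < c\<close> by simp
qed

lemma pi_times_div_sqrt_pi: "pi * x / (2 * sqrt pi) = sqrt pi / 2 * x"
proof -
  have "pi * x = sqrt pi * (sqrt pi * x)" by (simp flip: mult.assoc)
  then show ?thesis by (subst \<open>pi * x = _\<close>) simp
qed

lemma (in prob_space) Laplace_cdot:
  assumes u: "std_complex_normal_vec M u" and \<tau>: "0 \<le> \<tau>"
  shows "has_bochner_integral M (\<lambda>\<omega>. exp (- \<tau> * (cmod (cdot q (u \<omega>)))\<^sup>2)) (1 / (1 + \<tau> * (norm q)\<^sup>2))"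
proof -
  note [measurable] = std_complex_normal_vec_measurable[OF prob_space_axioms u]
  have "integrable M (\<lambda>\<omega>. exp (- \<tau> * (cmod (cdot q (u \<omega>)))\<^sup>2))"
    using \<tau> by (intro integrable_const_bound[where B = 1]) auto
  moreover have "expectation (\<lambda>\<omega>. exp (- \<tau> * (cmod (cdot q (u \<omega>)))\<^sup>2)) = 1 / (1 + \<tau> * (norm q)\<^sup>2)"
    using Laplace_cdot_pair[OF u, of 0 "complex_of_real (sqrt \<tau>) *s q"] \<tau>
    by (simp add: cdot_scale_left norm_mult norm_vector_scalar_mult power_mult_distrib)
      (simp add: cdot_def)
  ultimately show ?thesis by (simp add: has_bochner_integral_iff)
qed

lemma (in prob_space) nn_integral_one_minus_exp:
  assumes u: "std_complex_normal_vec M u" and \<tau>: "0 \<le> \<tau>"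
  shows "(\<integral>\<^sup>+\<omega>. ennreal (1 - exp (- \<tau> * (cmod (cdot q (u \<omega>)))\<^sup>2)) \<partial>M)
    = ennreal (\<tau> * ((norm q)\<^sup>2 / (1 + \<tau> * (norm q)\<^sup>2)))"
proof -
  have "has_bochner_integral M (\<lambda>\<omega>. 1 - exp (- \<tau> * (cmod (cdot q (u \<omega>)))\<^sup>2)) (1 - 1 / (1 + \<tau> * (norm q)\<^sup>2))"
    by (rule has_bochner_integral_diff[OF _ Laplace_cdot[OF u \<tau>]])
      (simp add: has_bochner_integral_iff prob_space)
  moreover have "1 - 1 / (1 + \<tau> * (norm q)\<^sup>2) = \<tau> * ((norm q)\<^sup>2 / (1 + \<tau> * (norm q)\<^sup>2))"
  proof -
    have "1 + \<tau> * (norm q)\<^sup>2 \<noteq> 0" using \<tau> by (simp add: add_nonneg_eq_0_iff)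
    then show ?thesis by (simp add: divide_simps)
  qed
  ultimately show ?thesis
    using \<tau> by (subst nn_integral_eq_integral) (auto simp: has_bochner_integral_iff)
qed

lemma (in prob_space) cmod_sq:
  assumes u: "std_complex_normal_vec M u"
  shows "has_bochner_integral M (\<lambda>\<omega>. (cmod (cdot q (u \<omega>)))\<^sup>2) ((norm q)\<^sup>2)"
proof -
  note [measurable] = std_complex_normal_vec_measurable[OF prob_space_axioms u]
  let ?b = "\<lambda>\<omega>. (cmod (cdot q (u \<omega>)))\<^sup>2"
  define f where "f k \<omega> = ennreal (2 ^ k * (1 - exp (- (1 / 2 ^ k) * ?b \<omega>)))" for k :: nat and \<omega>
  have lim: "(\<lambda>k. integral\<^sup>N M (f k)) \<longlonglongrightarrow> (\<integral>\<^sup>+\<omega>. ennreal (?b \<omega>) \<partial>M)"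
  proof (rule nn_integral_LIMSEQ)
    show "incseq f"
      using incseqD[OF incseq_one_minus_exp]
      by (auto simp: f_def intro!: monoI le_funI ennreal_leI)
    show "(\<lambda>k. f k \<omega>) \<longlonglongrightarrow> ennreal (?b \<omega>)" for \<omega>
      unfolding f_def by (intro tendsto_ennrealI tendsto_one_minus_exp)
    show "f k \<in> borel_measurable M" for k unfolding f_def by measurable
  qed
  have fk: "integral\<^sup>N M (f k) = ennreal ((norm q)\<^sup>2 / (1 + 1 / 2 ^ k * (norm q)\<^sup>2))" for k
  proof -
    have "integral\<^sup>N M (f k) = ennreal (2 ^ k) * (\<integral>\<^sup>+\<omega>. ennreal (1 - exp (- (1 / 2 ^ k) * ?b \<omega>)) \<partial>M)"
      unfolding f_def by (subst nn_integral_cmult[symmetric]) (auto simp flip: ennreal_mult')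
    also have "\<dots> = ennreal (2 ^ k * (1 / 2 ^ k * ((norm q)\<^sup>2 / (1 + 1 / 2 ^ k * (norm q)\<^sup>2))))"
      by (subst nn_integral_one_minus_exp[OF u]) (auto simp flip: ennreal_mult')
    finally show ?thesis by simp
  qed
  have "(\<lambda>k::nat. 1 / 2 ^ k :: real) \<longlonglongrightarrow> 0" by real_asymp
  then have "(\<lambda>k::nat. (norm q)\<^sup>2 / (1 + 1 / 2 ^ k * (norm q)\<^sup>2)) \<longlonglongrightarrow> (norm q)\<^sup>2 / (1 + 0 * (norm q)\<^sup>2)"
    by (intro tendsto_intros) auto
  from LIMSEQ_unique[OF lim[unfolded fk] tendsto_ennrealI[OF this]] show ?thesis
    by (intro has_bochner_integral_nn_integral) auto
qed

text \<open>The indicator of the event that the functional vanishes is at most exp (-\<tau> |z|^2)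
  for every \<tau>, so its probability is bounded by a transform that tends to 0 as \<tau>
  grows.\<close>

lemma (in prob_space) AE_cdot_nonzero:
  assumes u: "std_complex_normal_vec M u" and v: "v \<noteq> 0"
  shows "AE \<omega> in M. cdot v (u \<omega>) \<noteq> 0"
proof -
  note [measurable] = std_complex_normal_vec_measurable[OF prob_space_axioms u]
  let ?E = "{\<omega> \<in> space M. cdot v (u \<omega>) = 0}"
  have le: "prob ?E \<le> 1 / (1 + \<tau> * (norm v)\<^sup>2)" if \<tau>: "0 \<le> \<tau>" for \<tau>
  proof -
    have "prob ?E = expectation (indicator ?E)" by simp
    also have "\<dots> \<le> expectation (\<lambda>\<omega>. exp (- \<tau> * (cmod (cdot v (u \<omega>)))\<^sup>2))"
      using Laplace_cdot[OF u \<tau>, of v]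
      by (intro integral_mono) (auto simp: has_bochner_integral_iff indicator_def less_top[symmetric])
    also have "\<dots> = 1 / (1 + \<tau> * (norm v)\<^sup>2)"
      using Laplace_cdot[OF u \<tau>, of v] by (simp add: has_bochner_integral_iff)
    finally show ?thesis .
  qed
  have "prob ?E = 0"
  proof (rule ccontr)
    define e where "e = prob ?E"
    assume "prob ?E \<noteq> 0"
    then have e: "e > 0" by (simp add: e_def zero_less_measure_iff)
    \<comment> \<open>The choice \<tau> = 1 / (e |v|^2) turns the bound into e / (e + 1), which is
      below e.\<close>
    have "e \<le> 1 / (1 + 1 / (e * (norm v)\<^sup>2) * (norm v)\<^sup>2)"
      unfolding e_def by (rule le) (simp add: measure_nonneg)
    also have "\<dots> = 1 / (1 + 1 / e)" using v by simp
    also have "\<dots> < e" using e by (simp add: field_simps)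
    finally show False by simp
  qed
  then show ?thesis
    by (subst (asm) prob_eq_0) auto
qed

lemma (in prob_space) cmod_unit:
  assumes u: "std_complex_normal_vec M u" and q: "norm q = 1"
  shows "has_bochner_integral M (\<lambda>\<omega>. cmod (cdot q (u \<omega>))) (sqrt pi / 2)"
proof -
  note [measurable] = std_complex_normal_vec_measurable[OF prob_space_axioms u]
  have "(\<integral>\<^sup>+\<omega>. 1 * ennreal (2 * sqrt pi * cmod (cdot q (u \<omega>))) \<partial>M)
      = (\<integral>\<^sup>+s. \<integral>\<^sup>+\<omega>. 1 * ennreal ((1 - exp (- s\<^sup>2 * (cmod (cdot q (u \<omega>)))\<^sup>2)) / s\<^sup>2) \<partial>M \<partial>lborel)"
    by (rule nn_integral_Bernstein) auto
  also have "\<dots> = (\<integral>\<^sup>+s. ennreal (1 / (1 + s\<^sup>2)) \<partial>lborel)"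
  proof (rule nn_integral_cong_AE, rule AE_mp[OF AE_lborel_nonzero], intro AE_I2 impI)
    fix s :: real assume s: "s \<noteq> 0"
    have "(\<integral>\<^sup>+\<omega>. 1 * ennreal ((1 - exp (- s\<^sup>2 * (cmod (cdot q (u \<omega>)))\<^sup>2)) / s\<^sup>2) \<partial>M)
        = (\<integral>\<^sup>+\<omega>. ennreal (1 / s\<^sup>2) * ennreal (1 - exp (- s\<^sup>2 * (cmod (cdot q (u \<omega>)))\<^sup>2)) \<partial>M)"
      by (intro nn_integral_cong) (simp flip: ennreal_mult')
    also have "\<dots> = ennreal (1 / s\<^sup>2) * ennreal (s\<^sup>2 * (1 / (1 + s\<^sup>2)))"
      using nn_integral_one_minus_exp[OF u, of "s\<^sup>2" q]
      by (subst nn_integral_cmult) (auto simp: q)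
    also have "\<dots> = ennreal (1 / (1 + s\<^sup>2))"
      using s by (simp flip: ennreal_mult')
    finally show "(\<integral>\<^sup>+\<omega>. 1 * ennreal ((1 - exp (- s\<^sup>2 * (cmod (cdot q (u \<omega>)))\<^sup>2)) / s\<^sup>2) \<partial>M)
        = ennreal (1 / (1 + s\<^sup>2))" .
  qed
  also have "\<dots> = ennreal pi" by (rule nn_integral_cauchy_kernel)
  finally have "has_bochner_integral M (\<lambda>\<omega>. cmod (cdot q (u \<omega>))) (pi / (2 * sqrt pi))"
    by (intro has_bochner_integral_of_nn_integral_scaled) auto
  then have "has_bochner_integral M (\<lambda>\<omega>. cmod (cdot q (u \<omega>))) (pi * 1 / (2 * sqrt pi))" by simp
  then show ?thesis unfolding pi_times_div_sqrt_pi by simp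
qed

text \<open>For a unit vector q the two terms of the half-transformed moment integrate to pi (Cauchy
  kernel) and pi / 2 (Beta kernel with n = 0). This ratio is the origin of the 1/2 in the second
  summand of \<open>B\<close>.\<close>

lemma (in prob_space) cmod_sq_cmod_unit:
  assumes u: "std_complex_normal_vec M u" and q: "norm q = 1"
  shows "has_bochner_integral M (\<lambda>\<omega>. (cmod (cdot p (u \<omega>)))\<^sup>2 * cmod (cdot q (u \<omega>)))
    (sqrt pi / 2 * ((norm p)\<^sup>2 + (cmod (cdot p q))\<^sup>2 / 2))"
proof -
  note [measurable] = std_complex_normal_vec_measurable[OF prob_space_axioms u]
  let ?a = "\<lambda>\<omega>. (cmod (cdot p (u \<omega>)))\<^sup>2"
  define P C where "P = (norm p)\<^sup>2" and "C = (cmod (cdot p q))\<^sup>2"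
  have PC: "0 \<le> P" "0 \<le> C" by (auto simp: P_def C_def)
  have "(\<integral>\<^sup>+\<omega>. ennreal (?a \<omega>) * ennreal (2 * sqrt pi * cmod (cdot q (u \<omega>))) \<partial>M)
      = (\<integral>\<^sup>+s. \<integral>\<^sup>+\<omega>. ennreal (?a \<omega>) * ennreal ((1 - exp (- s\<^sup>2 * (cmod (cdot q (u \<omega>)))\<^sup>2)) / s\<^sup>2) \<partial>M \<partial>lborel)"
    by (rule nn_integral_Bernstein) auto
  also have "\<dots> = (\<integral>\<^sup>+s. ennreal P * ennreal (1 / (1 + s\<^sup>2)) + ennreal C * ennreal (s ^ (2 * 0) / (1 + s\<^sup>2) ^ (0 + 2)) \<partial>lborel)"
  proof (rule nn_integral_cong_AE, rule AE_mp[OF AE_lborel_nonzero], intro AE_I2 impI)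
    fix s :: real assume s: "s \<noteq> 0"
    have "(\<integral>\<^sup>+\<omega>. ennreal (?a \<omega>) * ennreal ((1 - exp (- s\<^sup>2 * (cmod (cdot q (u \<omega>)))\<^sup>2)) / s\<^sup>2) \<partial>M)
       = (\<integral>\<^sup>+\<omega>. ennreal (1 / s\<^sup>2) * ennreal (?a \<omega> * (1 - exp (- s\<^sup>2 * (cmod (cdot q (u \<omega>)))\<^sup>2))) \<partial>M)"
      by (intro nn_integral_cong) (simp flip: ennreal_mult')
    also have "\<dots> = ennreal (1 / s\<^sup>2) * ennreal (s\<^sup>2 * (P * 1 / (1 + s\<^sup>2) + C / (1 + s\<^sup>2)\<^sup>2))"
      using nn_integral_cmod_sq_one_minus_exp[OF u, of "s\<^sup>2" p q]
      by (subst nn_integral_cmult) (auto simp: q P_def C_def)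
    also have "\<dots> = ennreal (P / (1 + s\<^sup>2) + C / (1 + s\<^sup>2)\<^sup>2)"
      using s by (simp flip: ennreal_mult')
    also have "\<dots> = ennreal P * ennreal (1 / (1 + s\<^sup>2)) + ennreal C * ennreal (s ^ (2 * 0) / (1 + s\<^sup>2) ^ (0 + 2))"
      using PC by (simp add: numeral_2_eq_2 flip: ennreal_mult' ennreal_plus)
    finally show "(\<integral>\<^sup>+\<omega>. ennreal (?a \<omega>) * ennreal ((1 - exp (- s\<^sup>2 * (cmod (cdot q (u \<omega>)))\<^sup>2)) / s\<^sup>2) \<partial>M) = \<dots>" .
  qed
  also have "\<dots> = ennreal P * ennreal pi + ennreal C * ennreal (- pi * hyp_coeff (Suc 0))"
    by (subst nn_integral_add) (auto simp: nn_integral_cmult nn_integral_cauchy_kernel nn_integral_beta_kernel[of 0, simplified])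
  also have "\<dots> = ennreal (pi * (P + C / 2))"
    using PC by (simp add: hyp_coeff_Suc hyp_coeff_0 algebra_simps flip: ennreal_mult' ennreal_plus)
  finally have "has_bochner_integral M (\<lambda>\<omega>. ?a \<omega> * cmod (cdot q (u \<omega>))) (pi * (P + C / 2) / (2 * sqrt pi))"
    using PC by (intro has_bochner_integral_of_nn_integral_scaled) (auto simp: mult_ac simp flip: ennreal_mult')
  then show ?thesis unfolding pi_times_div_sqrt_pi P_def C_def .
qed

text \<open>A geometric series in C s^2 t^2 / D, whose ratio is below 1 even for C = 1. Each term is
  a function of s times the same function of t, so the double integral splits into squares of Beta
  integrals.\<close>

lemma pair_kernel_series:
  assumes C: "0 \<le> C" "C \<le> 1"
  shows "ennreal (pair_kernel 1 1 C (s\<^sup>2) (t\<^sup>2)) = ennreal (1 / (1 + s\<^sup>2)) * ennreal (1 / (1 + t\<^sup>2))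
    + (\<Sum>n. ennreal (C ^ Suc n) * (ennreal (s ^ (2 * n) / (1 + s\<^sup>2) ^ (n + 2)) * ennreal (t ^ (2 * n) / (1 + t\<^sup>2) ^ (n + 2))))"
proof -
  define D where "D = (1 + s\<^sup>2) * (1 + t\<^sup>2)"
  define x where "x = s\<^sup>2 * t\<^sup>2 * C / D"
  have D: "D > 0" by (simp add: D_def add_pos_nonneg)
  have "s\<^sup>2 * t\<^sup>2 * C \<le> s\<^sup>2 * t\<^sup>2" using C by (simp add: mult_left_le)
  also have "\<dots> < D" by (simp add: D_def algebra_simps add_pos_nonneg)
  finally have lt: "s\<^sup>2 * t\<^sup>2 * C < D" .
  then have x: "0 \<le> x" "x < 1" using C D by (auto simp: x_def)
  have "(\<lambda>n. C / D\<^sup>2 * x ^ n) sums (C / D\<^sup>2 * (1 / (1 - x)))"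
    using x by (intro sums_mult geometric_sums) auto
  moreover have "C / D\<^sup>2 * (1 / (1 - x)) = C / (D * (D - s\<^sup>2 * t\<^sup>2 * C))"
  proof -
    have "D * (1 - x) = D - s\<^sup>2 * t\<^sup>2 * C" using D by (simp add: x_def right_diff_distrib)
    then have "D * (D - s\<^sup>2 * t\<^sup>2 * C) = D\<^sup>2 * (1 - x)" by (metis mult.assoc power2_eq_square)
    then show ?thesis by simp
  qed
  moreover have "C / D\<^sup>2 * x ^ n = C ^ Suc n * ((s ^ (2 * n) / (1 + s\<^sup>2) ^ (n + 2)) * (t ^ (2 * n) / (1 + t\<^sup>2) ^ (n + 2)))" for n
    by (simp add: x_def D_def power_divide power_mult_distrib power_add power2_eq_square power_mult mult_ac)
  ultimately have "(\<lambda>n. C ^ Suc n * ((s ^ (2 * n) / (1 + s\<^sup>2) ^ (n + 2)) * (t ^ (2 * n) / (1 + t\<^sup>2) ^ (n + 2))))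
      sums (C / (D * (D - s\<^sup>2 * t\<^sup>2 * C)))" by (simp only:)
  then have "(\<Sum>n. ennreal (C ^ Suc n * ((s ^ (2 * n) / (1 + s\<^sup>2) ^ (n + 2)) * (t ^ (2 * n) / (1 + t\<^sup>2) ^ (n + 2)))))
      = ennreal (C / (D * (D - s\<^sup>2 * t\<^sup>2 * C)))"
    using C by (intro suminf_ennreal_eq) (auto simp: power_mult intro!: mult_nonneg_nonneg divide_nonneg_nonneg)
  moreover have "pair_kernel 1 1 C (s\<^sup>2) (t\<^sup>2) = 1 / (1 + s\<^sup>2) * (1 / (1 + t\<^sup>2)) + C / (D * (D - s\<^sup>2 * t\<^sup>2 * C))"
    by (simp add: pair_kernel_def Let_def D_def)
  moreover have "ennreal (C ^ Suc n) * (ennreal (s ^ (2 * n) / (1 + s\<^sup>2) ^ (n + 2)) * ennreal (t ^ (2 * n) / (1 + t\<^sup>2) ^ (n + 2)))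
      = ennreal (C ^ Suc n * ((s ^ (2 * n) / (1 + s\<^sup>2) ^ (n + 2)) * (t ^ (2 * n) / (1 + t\<^sup>2) ^ (n + 2))))" for n
  proof -
    have "0 \<le> s ^ (2 * n) / (1 + s\<^sup>2) ^ (n + 2)" "0 \<le> t ^ (2 * n) / (1 + t\<^sup>2) ^ (n + 2)" "0 \<le> C ^ Suc n"
      using C by (simp_all add: power_mult)
    then show ?thesis by (metis ennreal_mult mult_nonneg_nonneg)
  qed
  moreover have "ennreal (1 / (1 + s\<^sup>2)) * ennreal (1 / (1 + t\<^sup>2)) = ennreal (1 / (1 + s\<^sup>2) * (1 / (1 + t\<^sup>2)))"
    by (rule ennreal_mult[symmetric]) auto
  moreover have "0 \<le> 1 / (1 + s\<^sup>2) * (1 / (1 + t\<^sup>2))" "0 \<le> C / (D * (D - s\<^sup>2 * t\<^sup>2 * C))"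
    using C D lt by auto
  ultimately show ?thesis by (simp only: ennreal_plus)
qed

text \<open>The two Beta integrals in the n-th term give pi^2 times the square of
  \<open>hyp_coeff (Suc n)\<close>, and dividing by (2 sqrt pi)^2 = 4 pi leaves the factor pi / 4.
  All terms are nonnegative, so sums and integrals commute up to and including |E z* w| = 1.\<close>

lemma (in prob_space) cmod_cmod_unit:
  assumes u: "std_complex_normal_vec M u" and p: "norm p = 1" and q: "norm q = 1"
  shows "has_bochner_integral M (\<lambda>\<omega>. cmod (cdot p (u \<omega>)) * cmod (cdot q (u \<omega>)))
    (pi / 4 * hyp_term ((cmod (cdot p q))\<^sup>2))"
proof -
  note [measurable] = std_complex_normal_vec_measurable[OF prob_space_axioms u]
  let ?a = "\<lambda>\<omega>. cmod (cdot p (u \<omega>))" and ?b = "\<lambda>\<omega>. cmod (cdot q (u \<omega>))"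
  let ?k = "\<lambda>s y::real. ennreal ((1 - exp (- s\<^sup>2 * y\<^sup>2)) / s\<^sup>2)"
  let ?J = "\<lambda>n s::real. ennreal (s ^ (2 * n) / (1 + s\<^sup>2) ^ (n + 2))"
  define C where "C = (cmod (cdot p q))\<^sup>2"
  have C: "0 \<le> C" "C \<le> 1" using cdot_Cauchy_Schwarz[of p q] by (auto simp: C_def p q)
  have "(\<integral>\<^sup>+\<omega>. ennreal (2 * sqrt pi * ?b \<omega>) * ennreal (2 * sqrt pi * ?a \<omega>) \<partial>M)
      = (\<integral>\<^sup>+s. \<integral>\<^sup>+\<omega>. ennreal (2 * sqrt pi * ?b \<omega>) * ?k s (?a \<omega>) \<partial>M \<partial>lborel)"
    by (rule nn_integral_Bernstein) auto
  also have "\<dots> = (\<integral>\<^sup>+s. \<integral>\<^sup>+t. \<integral>\<^sup>+\<omega>. ?k s (?a \<omega>) * ?k t (?b \<omega>) \<partial>M \<partial>lborel \<partial>lborel)"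
    by (subst nn_integral_Bernstein[symmetric]) (auto simp: mult.commute)
  also have "\<dots> = (\<integral>\<^sup>+s. \<integral>\<^sup>+t. ennreal (1 / (1 + s\<^sup>2)) * ennreal (1 / (1 + t\<^sup>2)) +
      (\<Sum>n. ennreal (C ^ Suc n) * (?J n s * ?J n t)) \<partial>lborel \<partial>lborel)"
  proof (rule nn_integral_cong_AE, rule AE_mp[OF AE_lborel_nonzero], intro AE_I2 impI,
      rule nn_integral_cong_AE, rule AE_mp[OF AE_lborel_nonzero], intro AE_I2 impI)
    fix s t :: real assume s: "s \<noteq> 0" and t: "t \<noteq> 0"
    have "(\<integral>\<^sup>+\<omega>. ?k s (?a \<omega>) * ?k t (?b \<omega>) \<partial>M)
        = (\<integral>\<^sup>+\<omega>. ennreal (1 / (s\<^sup>2 * t\<^sup>2)) * ennreal ((1 - exp (- s\<^sup>2 * (?a \<omega>)\<^sup>2)) * (1 - exp (- t\<^sup>2 * (?b \<omega>)\<^sup>2))) \<partial>M)"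
      by (intro nn_integral_cong) (simp flip: ennreal_mult')
    also have "\<dots> = ennreal (1 / (s\<^sup>2 * t\<^sup>2)) * ennreal (s\<^sup>2 * t\<^sup>2 * pair_kernel 1 1 C (s\<^sup>2) (t\<^sup>2))"
      using nn_integral_cdot_pair[OF u, of "s\<^sup>2" "t\<^sup>2" p q]
      by (subst nn_integral_cmult) (auto simp: p q C_def)
    also have "\<dots> = ennreal (pair_kernel 1 1 C (s\<^sup>2) (t\<^sup>2))"
      using s t by (simp flip: ennreal_mult')
    finally show "(\<integral>\<^sup>+\<omega>. ?k s (?a \<omega>) * ?k t (?b \<omega>) \<partial>M) = ennreal (1 / (1 + s\<^sup>2)) * ennreal (1 / (1 + t\<^sup>2)) +
        (\<Sum>n. ennreal (C ^ Suc n) * (?J n s * ?J n t))"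
      by (simp only: pair_kernel_series[OF C])
  qed
  also have "\<dots> = ennreal pi * ennreal pi
      + (\<Sum>n. ennreal (C ^ Suc n) * (ennreal (- pi * hyp_coeff (Suc n)) * ennreal (- pi * hyp_coeff (Suc n))))"
    by (simp add: nn_integral_add nn_integral_suminf nn_integral_cmult nn_integral_multc
        nn_integral_cauchy_kernel nn_integral_beta_kernel del: power_Suc add_2_eq_Suc' mult_minus_left)
  also have "\<dots> = ennreal (pi\<^sup>2 * hyp_term C)"
  proof -
    have "(\<lambda>n. pi\<^sup>2 * ((hyp_coeff n)\<^sup>2 * C ^ n)) sums (pi\<^sup>2 * hyp_term C)"
      by (intro sums_mult hyp_term_sums C)
    \<comment> \<open>The product of the two Cauchy integrals, pi^2, is the missing term of index 0,
      since \<open>hyp_coeff 0\<close> is 1.\<close>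
    then have S: "(\<lambda>n. pi\<^sup>2 * ((hyp_coeff (Suc n))\<^sup>2 * C ^ Suc n)) sums (pi\<^sup>2 * hyp_term C - pi\<^sup>2)"
      by (subst sums_Suc_iff) (simp add: hyp_coeff_0)
    have nn: "0 \<le> pi\<^sup>2 * hyp_term C - pi\<^sup>2"
      by (rule sums_le[OF _ sums_zero S]) (use C in simp)
    have "(\<Sum>n. ennreal (C ^ Suc n) * (ennreal (- pi * hyp_coeff (Suc n)) * ennreal (- pi * hyp_coeff (Suc n))))
        = (\<Sum>n. ennreal (pi\<^sup>2 * ((hyp_coeff (Suc n))\<^sup>2 * C ^ Suc n)))"
      using C hyp_coeff_Suc_nonpos
      by (intro suminf_cong) (simp add: mult_nonneg_nonpos power2_eq_square mult_ac flip: ennreal_mult')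
    also have "\<dots> = ennreal (pi\<^sup>2 * hyp_term C - pi\<^sup>2)"
      using C by (intro suminf_ennreal_eq S) simp
    finally show ?thesis
      using nn by (simp add: power2_eq_square flip: ennreal_mult' ennreal_plus)
  qed
  finally have *: "(\<integral>\<^sup>+\<omega>. ennreal (2 * sqrt pi * ?b \<omega>) * ennreal (2 * sqrt pi * ?a \<omega>) \<partial>M) = ennreal (pi\<^sup>2 * hyp_term C)" .
  have "(\<integral>\<^sup>+\<omega>. ennreal (4 * pi * (?a \<omega> * ?b \<omega>)) \<partial>M) = ennreal (pi\<^sup>2 * hyp_term C)"
  proof -
    have "ennreal (2 * sqrt pi * ?b \<omega>) * ennreal (2 * sqrt pi * ?a \<omega>) = ennreal (4 * pi * (?a \<omega> * ?b \<omega>))" for \<omega>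
    proof -
      have "2 * sqrt pi * ?b \<omega> * (2 * sqrt pi * ?a \<omega>) = 4 * (sqrt pi * sqrt pi) * (?a \<omega> * ?b \<omega>)" by algebra
      also have "\<dots> = 4 * pi * (?a \<omega> * ?b \<omega>)" by simp
      finally show ?thesis by (subst ennreal_mult'[symmetric]) (simp_all only:, simp)
    qed
    then show ?thesis using * by (simp only:)
  qed
  moreover have "0 \<le> hyp_term C"
    by (rule sums_le[OF _ sums_zero hyp_term_sums[OF C]]) (use C in simp)
  ultimately have "has_bochner_integral M (\<lambda>\<omega>. ?a \<omega> * ?b \<omega>) (pi\<^sup>2 * hyp_term C / (4 * pi))"
    by (intro has_bochner_integral_of_nn_integral_scaled) auto
  then show ?thesis by (simp add: power2_eq_square C_def)
qed

subsection \<open>Moments of the correlated channels\<close>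

text \<open>Preimages under f o X lie in the sigma-algebra generated by X. Once both sides are
  mapped to a common type, here the reals, the library's \<open>indep_var\<close> and its product
  rule for expectations become available.\<close>

lemma indep_rvs_compose:
  fixes X :: "'a \<Rightarrow> 'b::topological_space" and Z :: "'a \<Rightarrow> 'c::topological_space"
  assumes "prob_space M" and ind: "indep_rvs M X Z"
    and f: "f \<in> borel_measurable borel" and g: "g \<in> borel_measurable borel"
  shows "prob_space.indep_var M borel (\<lambda>\<omega>. f (X \<omega>)) borel (\<lambda>\<omega>. g (Z \<omega>))"
proof -
  interpret prob_space M by fact
  have [measurable]: "X \<in> borel_measurable M" "Z \<in> borel_measurable M"
    and iset: "indep_set (sets (vimage_algebra (space M) X borel)) (sets (vimage_algebra (space M) Z borel))"
    using ind by (auto simp: indep_rvs_def)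
  note [measurable] = f g
  have sub: "sigma_sets (space M) {(\<lambda>\<omega>. h (W \<omega>)) -` A \<inter> space M |A. A \<in> sets borel}
      \<subseteq> sets (vimage_algebra (space M) W borel)"
    if h: "h \<in> borel_measurable borel"
    for h :: "'e::topological_space \<Rightarrow> 'f::topological_space" and W
  proof -
    have "{(\<lambda>\<omega>. h (W \<omega>)) -` A \<inter> space M |A. A \<in> sets borel} \<subseteq> sets (vimage_algebra (space M) W borel)"
    proof clarify
      fix A :: "'f set" assume "A \<in> sets borel"
      then have "h -` A \<in> sets borel" using measurable_sets[OF h] by simp
      moreover have "(\<lambda>\<omega>. h (W \<omega>)) -` A \<inter> space M = W -` (h -` A) \<inter> space M" by auto
      ultimately show "(\<lambda>\<omega>. h (W \<omega>)) -` A \<inter> space M \<in> sets (vimage_algebra (space M) W borel)"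
        by (simp add: in_vimage_algebra)
    qed
    then show ?thesis
      using sets.sigma_sets_subset[of _ "vimage_algebra (space M) W borel"] by simp
  qed
  have "indep_set (sigma_sets (space M) {(\<lambda>\<omega>. f (X \<omega>)) -` A \<inter> space M |A. A \<in> sets borel})
      (sigma_sets (space M) {(\<lambda>\<omega>. g (Z \<omega>)) -` A \<inter> space M |A. A \<in> sets borel})"
    using iset sub[OF f, of X] sub[OF g, of Z] unfolding indep_set_def
    by (elim indep_sets_mono_sets) (auto split: bool.split)
  then show ?thesis
    unfolding indep_var_eq by simp
qed

lemma (in prob_space) has_bochner_integral_indep_mult:
  fixes X1 X2 :: "'a \<Rightarrow> real"
  assumes "indep_var borel X1 borel X2" "has_bochner_integral M X1 a" "has_bochner_integral M X2 b"
  shows "has_bochner_integral M (\<lambda>\<omega>. X1 \<omega> * X2 \<omega>) (a * b)"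
  using indep_var_lebesgue_integral[OF assms(1)] indep_var_integrable[OF assms(1)] assms(2,3)
  by (simp add: has_bochner_integral_iff)

lemma borel_measurable_cdot [measurable]: "cdot p \<in> borel_measurable borel"
  unfolding cdot_def[abs_def]
  by (intro borel_measurable_continuous_onI continuous_intros)

text \<open>The conjugate undoes the one in the first argument of \<open>cdot\<close>, so that the
  coordinates of \<open>S *v u\<close> become functionals of the form treated above.\<close>

definition cnj_row :: "complex ^ 'n ^ 'm \<Rightarrow> 'm \<Rightarrow> complex ^ 'n" where
  "cnj_row S i = (\<chi> j. cnj (S $ i $ j))"

lemma cdot_cnj_row: "cdot (cnj_row S i) u = (S *v u) $ i"
  by (simp add: cdot_def cnj_row_def matrix_vector_mult_def)

text \<open>The Gram matrix of the rows. For the root of R it is R itself, so rho_ij is the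
  covariance of two coordinates and the unit diagonal says that the rows are unit vectors.\<close>

lemma cdot_cnj_row_cnj_row:
  assumes "hermitian S"
  shows "cdot (cnj_row S i) (cnj_row S j) = (S ** S) $ i $ j"
  using assms by (simp add: cdot_cnj_row, simp add: cnj_row_def matrix_vector_mult_def matrix_matrix_mult_def)
    (metis hermitian_def)

lemma norm_cnj_row_sqrt:
  assumes "correlation_matrix R"
  shows "norm (cnj_row (mat_sqrt R) i) = 1"
proof -
  have S: "hermitian (mat_sqrt R)" "mat_sqrt R ** mat_sqrt R = R"
    using mat_sqrt_psd[of R] assms by (auto simp: correlation_matrix_def psd_def)
  have "complex_of_real ((norm (cnj_row (mat_sqrt R) i))\<^sup>2) = 1"
    using assms unfolding norm_sq_eq_cdot cdot_cnj_row_cnj_row[OF S(1)] S(2)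
    by (simp add: correlation_matrix_def)
  then have "(norm (cnj_row (mat_sqrt R) i))\<^sup>2 = 1" using of_real_eq_1_iff by blast
  then show ?thesis by (simp add: power2_eq_1_iff) (smt (verit) norm_ge_zero)
qed

lemma trace_hermitian_sq:
  assumes "hermitian R"
  shows "Re (trace (R ** R)) = (\<Sum>i\<in>UNIV. \<Sum>j\<in>UNIV. (cmod (R $ i $ j))\<^sup>2)"
proof -
  have "R $ i $ j * R $ j $ i = complex_of_real ((cmod (R $ i $ j))\<^sup>2)" for i j
    using assms by (metis complex_norm_square hermitian_def)
  then show ?thesis by (simp add: trace_def matrix_matrix_mult_def)
qed

section \<open>Moments of one correlated channel, instantiated for both links\<close>

context
  fixes M :: "'a measure" and R :: "complex ^ 'k ^ 'k" and u :: "'a \<Rightarrow> complex ^ 'k"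
  assumes pM: "prob_space M" and R: "correlation_matrix R" and u: "std_complex_normal_vec M u"
begin

interpretation prob_space M by (rule pM)

lemma row_facts:
  "cdot (cnj_row (mat_sqrt R) i) (cnj_row (mat_sqrt R) j) = R $ i $ j"
  "hermitian (mat_sqrt R)" "mat_sqrt R ** mat_sqrt R = R" "hermitian R"
  using mat_sqrt_psd[of R] R cdot_cnj_row_cnj_row[of "mat_sqrt R" i j]
  by (auto simp: correlation_matrix_def psd_def)

lemma norm_sq_rows: "(norm (mat_sqrt R *v x))\<^sup>2 = (\<Sum>i\<in>UNIV. (cmod (cdot (cnj_row (mat_sqrt R) i) x))\<^sup>2)"
  by (simp add: norm_vec_sq cdot_cnj_row)

lemma expectation_norm_sq:
  "has_bochner_integral M (\<lambda>\<omega>. (norm (mat_sqrt R *v u \<omega>))\<^sup>2) (real CARD('k))"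
proof -
  have "has_bochner_integral M (\<lambda>\<omega>. \<Sum>i\<in>UNIV. (cmod (cdot (cnj_row (mat_sqrt R) i) (u \<omega>)))\<^sup>2)
      (\<Sum>i\<in>UNIV. (norm (cnj_row (mat_sqrt R) i))\<^sup>2)"
    by (intro has_bochner_integral_sum cmod_sq u)
  then show ?thesis by (simp add: norm_sq_rows norm_cnj_row_sqrt[OF R])
qed

text \<open>Expanding the squared norm into coordinates and using Wick's formula, each pair
  contributes 1 + |R_ij|^2; the second parts add up to tr R^2 by Hermitian symmetry.\<close>

lemma expectation_norm_sq_sq:
  "has_bochner_integral M (\<lambda>\<omega>. ((norm (mat_sqrt R *v u \<omega>))\<^sup>2)\<^sup>2) ((real CARD('k))\<^sup>2 + Re (trace (R ** R)))"
proof -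
  let ?r = "cnj_row (mat_sqrt R)"
  have "has_bochner_integral M (\<lambda>\<omega>. \<Sum>i\<in>UNIV. \<Sum>j\<in>UNIV. (cmod (cdot (?r i) (u \<omega>)))\<^sup>2 * (cmod (cdot (?r j) (u \<omega>)))\<^sup>2)
      (\<Sum>i\<in>UNIV. \<Sum>j\<in>UNIV. (norm (?r i))\<^sup>2 * (norm (?r j))\<^sup>2 + (cmod (cdot (?r i) (?r j)))\<^sup>2)"
    by (intro has_bochner_integral_sum cmod_sq_cmod_sq u)
  then show ?thesis
    by (simp add: norm_sq_rows norm_cnj_row_sqrt[OF R] row_facts sum.distrib trace_hermitian_sq sum_product
        power2_eq_square[of "sum _ _"] power2_eq_square[of "real _"])
qed

text \<open>Normalising v to a unit vector w reduces to \<open>cmod_unit\<close> and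
  \<open>cmod_sq_cmod_unit\<close>. Over the rows, the covariance terms |(S w)_i|^2 / 2 sum to |S
  w|^2 / 2, and undoing the normalisation gives the summand divided by 2 |v|.\<close>

lemma cmod_moments:
  assumes v: "v \<noteq> 0"
  shows "has_bochner_integral M (\<lambda>\<omega>. cmod (cdot v (u \<omega>))) (norm v * sqrt pi / 2)"
    and "has_bochner_integral M (\<lambda>\<omega>. (norm (mat_sqrt R *v u \<omega>))\<^sup>2 * cmod (cdot v (u \<omega>)))
      (sqrt pi / 2 * (norm v * real CARD('k) + (norm (mat_sqrt R *v v))\<^sup>2 / (2 * norm v)))"
proof -
  let ?r = "cnj_row (mat_sqrt R)"
  define w where "w = complex_of_real (1 / norm v) *s v"
  have w: "norm w = 1" using v by (simp add: w_def norm_vector_scalar_mult norm_divide)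
  have vw: "v = complex_of_real (norm v) *s w" using v by (simp add: w_def vec_eq_iff)
  have vc: "cmod (cdot v x) = norm v * cmod (cdot w x)" for x
    by (subst vw) (simp add: cdot_scale_left norm_mult)
  have "has_bochner_integral M (\<lambda>\<omega>. norm v * cmod (cdot w (u \<omega>))) (norm v * (sqrt pi / 2))"
    by (intro has_bochner_integral_mult_right cmod_unit u w)
  then show "has_bochner_integral M (\<lambda>\<omega>. cmod (cdot v (u \<omega>))) (norm v * sqrt pi / 2)"
    by (simp add: vc)
  have "has_bochner_integral M (\<lambda>\<omega>. norm v * (\<Sum>i\<in>UNIV. (cmod (cdot (?r i) (u \<omega>)))\<^sup>2 * cmod (cdot w (u \<omega>))))
      (norm v * (\<Sum>i\<in>UNIV. sqrt pi / 2 * ((norm (?r i))\<^sup>2 + (cmod (cdot (?r i) w))\<^sup>2 / 2)))"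
    by (intro has_bochner_integral_mult_right has_bochner_integral_sum cmod_sq_cmod_unit u w)
  also have "(\<lambda>\<omega>. norm v * (\<Sum>i\<in>UNIV. (cmod (cdot (?r i) (u \<omega>)))\<^sup>2 * cmod (cdot w (u \<omega>))))
      = (\<lambda>\<omega>. (norm (mat_sqrt R *v u \<omega>))\<^sup>2 * cmod (cdot v (u \<omega>)))"
    by (simp add: norm_sq_rows vc sum_distrib_right mult.left_commute)
  also have "norm v * (\<Sum>i\<in>UNIV. sqrt pi / 2 * ((norm (?r i))\<^sup>2 + (cmod (cdot (?r i) w))\<^sup>2 / 2))
      = sqrt pi / 2 * (norm v * real CARD('k) + norm v * (norm (mat_sqrt R *v w))\<^sup>2 / 2)"
    by (simp add: norm_sq_rows norm_cnj_row_sqrt[OF R] sum.distrib algebra_simps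
        flip: sum_distrib_left sum_divide_distrib)
  also have "(norm (mat_sqrt R *v w))\<^sup>2 = (norm (mat_sqrt R *v v))\<^sup>2 / (norm v)\<^sup>2"
    by (simp add: w_def vector_scalar_commute norm_vector_scalar_mult norm_divide power_divide)
  also have "norm v * ((norm (mat_sqrt R *v v))\<^sup>2 / (norm v)\<^sup>2) / 2 = (norm (mat_sqrt R *v v))\<^sup>2 / (2 * norm v)"
    using v by (simp add: power2_eq_square)
  finally show "has_bochner_integral M (\<lambda>\<omega>. (norm (mat_sqrt R *v u \<omega>))\<^sup>2 * cmod (cdot v (u \<omega>)))
      (sqrt pi / 2 * (norm v * real CARD('k) + (norm (mat_sqrt R *v v))\<^sup>2 / (2 * norm v)))" .
qed

abbreviation (input) amp_sum :: "'a \<Rightarrow> real" where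
  "amp_sum \<omega> \<equiv> \<Sum>n\<in>UNIV. cmod ((mat_sqrt R *v u \<omega>) $ n)"

lemma amp_sum_first: "has_bochner_integral M amp_sum (real CARD('k) * sqrt pi / 2)"
proof -
  have "has_bochner_integral M (\<lambda>\<omega>. \<Sum>i\<in>UNIV. cmod (cdot (cnj_row (mat_sqrt R) i) (u \<omega>))) (\<Sum>i\<in>(UNIV::'k set). sqrt pi / 2)"
    by (intro has_bochner_integral_sum cmod_unit u norm_cnj_row_sqrt R)
  then show ?thesis by (simp add: cdot_cnj_row)
qed

lemma amp_sum_second: "has_bochner_integral M (\<lambda>\<omega>. (amp_sum \<omega>)\<^sup>2) (real CARD('k) + corr_F R)"
proof -
  let ?r = "cnj_row (mat_sqrt R)"
  let ?e = "\<lambda>i j. if i = j then 1 else pi / 4 * hyp_term ((cmod (R $ i $ j))\<^sup>2)"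
  have e: "has_bochner_integral M (\<lambda>\<omega>. cmod (cdot (?r i) (u \<omega>)) * cmod (cdot (?r j) (u \<omega>))) (?e i j)" for i j
  proof (cases "i = j")
    case True
    then show ?thesis using cmod_sq[OF u, of "?r i"] by (simp add: norm_cnj_row_sqrt[OF R] power2_eq_square)
  next
    case False
    then show ?thesis
      using cmod_cmod_unit[OF u, of "?r i" "?r j"] by (simp add: norm_cnj_row_sqrt[OF R] row_facts)
  qed
  have "has_bochner_integral M (\<lambda>\<omega>. \<Sum>i\<in>UNIV. \<Sum>j\<in>UNIV. cmod (cdot (?r i) (u \<omega>)) * cmod (cdot (?r j) (u \<omega>)))
      (\<Sum>i\<in>UNIV. \<Sum>j\<in>UNIV. ?e i j)"
    by (intro has_bochner_integral_sum e)
  also have "(\<Sum>i\<in>UNIV. \<Sum>j\<in>UNIV. ?e i j) = (\<Sum>i\<in>UNIV. 1 + (\<Sum>j\<in>UNIV - {i}. pi / 4 * hyp_term ((cmod (R $ i $ j))\<^sup>2)))"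
  proof (rule sum.cong[OF refl])
    fix i :: 'k
    show "(\<Sum>j\<in>UNIV. ?e i j) = 1 + (\<Sum>j\<in>UNIV - {i}. pi / 4 * hyp_term ((cmod (R $ i $ j))\<^sup>2))"
      by (subst sum.remove[of UNIV i]) (auto intro!: sum.cong)
  qed
  also have "\<dots> = real CARD('k) + corr_F R" by (simp add: sum.distrib corr_F_def)
  finally show ?thesis by (simp add: cdot_cnj_row power2_eq_square sum_product)
qed

lemma amp_sum_measurable [measurable]: "amp_sum \<in> borel_measurable M"
  using amp_sum_first by (auto simp: has_bochner_integral_iff)

text \<open>Cauchy-Schwarz bounds the squared sum of amplitudes by the dimension times the squared
  norm, whose second moment is already known to be finite.\<close>

lemma amp_sum_fourth: "integrable M (\<lambda>\<omega>. amp_sum \<omega> ^ 4)"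
proof (rule Bochner_Integration.integrable_bound)
  show "integrable M (\<lambda>\<omega>. (real CARD('k))\<^sup>2 * ((norm (mat_sqrt R *v u \<omega>))\<^sup>2)\<^sup>2)"
    using expectation_norm_sq_sq by (auto simp: has_bochner_integral_iff)
  have "amp_sum \<omega> ^ 4 \<le> (real CARD('k))\<^sup>2 * ((norm (mat_sqrt R *v u \<omega>))\<^sup>2)\<^sup>2" for \<omega>
  proof -
    have "(amp_sum \<omega>)\<^sup>2 \<le> real CARD('k) * (norm (mat_sqrt R *v u \<omega>))\<^sup>2"
      using sum_squared_le_sum_of_squares[of "\<lambda>n. cmod ((mat_sqrt R *v u \<omega>) $ n)" UNIV]
      by (simp add: norm_vec_sq mult.commute)
    then have "((amp_sum \<omega>)\<^sup>2)\<^sup>2 \<le> (real CARD('k) * (norm (mat_sqrt R *v u \<omega>))\<^sup>2)\<^sup>2"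
      by (intro power_mono) auto
    then show ?thesis by (simp add: power_mult_distrib flip: power_mult)
  qed
  then show "AE \<omega> in M. norm (amp_sum \<omega> ^ 4) \<le> norm ((real CARD('k))\<^sup>2 * ((norm (mat_sqrt R *v u \<omega>))\<^sup>2)\<^sup>2)"
    by (intro AE_I2) simp
qed measurable

lemma amp_sum_third: "integrable M (\<lambda>\<omega>. amp_sum \<omega> ^ 3)"
proof (rule Bochner_Integration.integrable_bound)
  show "integrable M (\<lambda>\<omega>. (amp_sum \<omega>)\<^sup>2 + amp_sum \<omega> ^ 4)"
    using amp_sum_second amp_sum_fourth by (auto simp: has_bochner_integral_iff)
  have "y ^ 3 \<le> y\<^sup>2 + y ^ 4" if "0 \<le> y" for y :: real
  proof -
    \<comment> \<open>The second factor is (y - 1/2)^2 + 3/4, so the cube is controlled by the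
      neighbouring even powers.\<close>
    have "0 \<le> y\<^sup>2 * (1 - y + y\<^sup>2)"
      using zero_le_power2[of "y - 1/2"] by (intro mult_nonneg_nonneg) (auto simp: power2_eq_square algebra_simps)
    then show ?thesis by (simp add: power2_eq_square power3_eq_cube power4_eq_xxxx algebra_simps)
  qed
  then show "AE \<omega> in M. norm (amp_sum \<omega> ^ 3) \<le> norm ((amp_sum \<omega>)\<^sup>2 + amp_sum \<omega> ^ 4)"
    by (intro AE_I2) (simp add: sum_nonneg)
qed measurable

end

subsection \<open>The optimal SNR\<close>

lemma cdot_norm_sq: "Re (cdot x x) = (norm x)\<^sup>2"
  by (metis Re_complex_of_real norm_sq_eq_cdot)

text \<open>The phase matrix gives the n-th reflected entry the phase of the n-th entry of
  \<open>ar\<close>, up to the common factor \<psi>. The product with \<open>ar\<close> in the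
  rank-one channel therefore adds moduli.\<close>

lemma opt_channel_eq:
  fixes ab h_d :: "complex ^ 'm" and ar h :: "complex ^ 'n"
  assumes ar: "\<forall>i. cmod (ar $ i) = 1"
  shows "opt_channel \<beta>br ab ar h_d h
    = h_d + (sqrt \<beta>br * (cdot ab h_d / cmod (cdot ab h_d)) * (\<Sum>n\<in>UNIV. cmod (h $ n))) *s ab"
proof -
  define \<psi> where "\<psi> = cdot ab h_d / cmod (cdot ab h_d)"
  define L where "L = los_channel \<beta>br ab ar"
  define \<Phi> where "\<Phi> = opt_phase_matrix ab ar h_d h"
  have diag: "diag_mat d *v x = (\<chi> i. d $ i * x $ i)" for d x :: "complex ^ 'n"
    by (simp add: vec_eq_iff diag_mat_def matrix_vector_mult_def if_distrib if_distribR cong: if_cong)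
  have scal: "mat c *v x = c *s x" for c and x :: "complex ^ 'n"
    by (simp add: vec_eq_iff mat_def matrix_vector_mult_def if_distrib if_distribR cong: if_cong)
  have phase: "cis (- Arg z) * z = complex_of_real (cmod z)" for z
    using rcis_cmod_Arg[of z] by (metis add.left_inverse cis_mult cis_zero mult.commute mult.left_commute mult.right_neutral rcis_def)
  have \<Phi>: "\<Phi> *v h = (\<chi> i. \<psi> * (cis (Arg (ar $ i)) * cmod (h $ i)))"
    by (simp add: \<Phi>_def opt_phase_matrix_def Let_def diag scal phase \<psi>_def vec_eq_iff flip: matrix_vector_mul_assoc)
  have "L *v x = (sqrt \<beta>br * cdot ar x) *s ab" for x
    by (simp add: L_def los_channel_def vec_eq_iff matrix_vector_mult_def cdot_def sum_distrib_left sum_distrib_right mult_ac)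
  moreover have "cdot ar (\<Phi> *v h) = \<psi> * (\<Sum>n\<in>UNIV. complex_of_real (cmod (h $ n)))"
  proof -
    have "cnj (ar $ i) * cis (Arg (ar $ i)) = 1" for i
      using rcis_cmod_Arg[of "ar $ i"] ar by (simp add: rcis_def) (metis cis_cnj cis_mult add.left_inverse cis_zero)
    then have *: "cnj (ar $ i) * (\<psi> * (cis (Arg (ar $ i)) * x)) = \<psi> * x" for i x
      by (metis mult.assoc mult.commute mult.left_neutral)
    show ?thesis by (simp only: \<Phi> cdot_def vec_lambda_beta * sum_distrib_left)
  qed
  ultimately show ?thesis
    by (simp add: opt_channel_def L_def[symmetric] \<Phi>_def[symmetric] \<psi>_def[symmetric] mult.assoc
        flip: matrix_vector_mul_assoc)
qed

text \<open>The common phase \<psi> aligns the reflected signal with the direct one, so the cross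
  term is the product of the moduli. When \<open>cdot ab h_d\<close> is 0, \<psi> evaluates to 0 / 0
  = 0 and the reflected power disappears, hence the case distinction.\<close>

lemma opt_SNR_eq:
  fixes ab h_d :: "complex ^ 'm" and ar h :: "complex ^ 'n"
  assumes ar: "\<forall>i. cmod (ar $ i) = 1" and ab: "\<forall>i. cmod (ab $ i) = 1" and \<beta>: "0 \<le> \<beta>br"
  defines "Z \<equiv> \<Sum>n\<in>UNIV. cmod (h $ n)"
  shows "opt_SNR \<tau> \<beta>br ab ar h_d h
    = ((norm h_d)\<^sup>2 + 2 * sqrt \<beta>br * cmod (cdot ab h_d) * Z
        + (if cdot ab h_d = 0 then 0 else \<beta>br * real CARD('m) * Z\<^sup>2)) * \<tau>"
proof -
  define c where "c = cdot ab h_d"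
  define \<alpha> where "\<alpha> = sqrt \<beta>br * (c / cmod c) * Z"
  have n: "(norm ab)\<^sup>2 = real CARD('m)" using ab by (simp add: norm_vec_sq)
  have a: "(cmod \<alpha>)\<^sup>2 = (if c = 0 then 0 else \<beta>br * Z\<^sup>2)"
    using \<beta> by (simp add: \<alpha>_def norm_mult norm_divide power_mult_distrib)
  have i: "1 \<bullet> (\<alpha> * cdot h_d ab) = sqrt \<beta>br * cmod c * Z"
  proof -
    have "\<alpha> * cdot h_d ab = complex_of_real (sqrt \<beta>br * Z) * ((c * cnj c) / cmod c)"
      by (simp add: \<alpha>_def c_def cdot_cnj)
    also have "(c * cnj c) / cmod c = complex_of_real (cmod c)"
      by (cases "c = 0") (simp_all add: power2_eq_square flip: complex_norm_square)
    finally show ?thesis by (simp add: inner_complex_def)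
  qed
  have "opt_channel \<beta>br ab ar h_d h = 1 *s h_d + \<alpha> *s ab"
    by (simp add: opt_channel_eq[OF ar] \<alpha>_def c_def Z_def)
  then have "Re (cdot (opt_channel \<beta>br ab ar h_d h) (opt_channel \<beta>br ab ar h_d h))
      = (norm h_d)\<^sup>2 + (if c = 0 then 0 else \<beta>br * Z\<^sup>2) * real CARD('m) + 2 * (sqrt \<beta>br * cmod c * Z)"
    unfolding cdot_norm_sq by (simp only: norm_sq_add_scaled a n i norm_one power_one mult_1)
  then show ?thesis by (simp add: opt_SNR_def Let_def c_def algebra_simps)
qed

lemma powr_three_halves: "0 < x \<Longrightarrow> x powr (3/2) = x * sqrt x"
  using powr_add[of x 1 "1/2"] by (simp add: powr_half_sqrt)

text \<open>Each independence hypothesis factors one kind of mixed product in the first or second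
  moment. G and V are functions of the same vector, so E G V enters as a datum of its own. The a c
  contribution cancels because G and Y^2 are uncorrelated. The formula for X is assumed almost
  everywhere, to absorb the event on which \<psi> degenerates.\<close>

lemma (in prob_space) variance_signal_plus_interaction:
  fixes G V Y :: "'a \<Rightarrow> real"
  assumes G: "has_bochner_integral M G g1" "has_bochner_integral M (\<lambda>\<omega>. (G \<omega>)\<^sup>2) g2"
    and V: "has_bochner_integral M V v1" "has_bochner_integral M (\<lambda>\<omega>. (V \<omega>)\<^sup>2) v2"
    and GV: "has_bochner_integral M (\<lambda>\<omega>. G \<omega> * V \<omega>) gv"
    and Y: "has_bochner_integral M Y y1" "has_bochner_integral M (\<lambda>\<omega>. (Y \<omega>)\<^sup>2) y2"
      "has_bochner_integral M (\<lambda>\<omega>. Y \<omega> ^ 3) y3" "has_bochner_integral M (\<lambda>\<omega>. Y \<omega> ^ 4) y4"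
    and ind: "indep_var borel V borel Y" "indep_var borel (\<lambda>\<omega>. (V \<omega>)\<^sup>2) borel (\<lambda>\<omega>. (Y \<omega>)\<^sup>2)"
      "indep_var borel (\<lambda>\<omega>. G \<omega> * V \<omega>) borel Y" "indep_var borel G borel (\<lambda>\<omega>. (Y \<omega>)\<^sup>2)"
      "indep_var borel V borel (\<lambda>\<omega>. Y \<omega> ^ 3)"
    and X: "AE \<omega> in M. X \<omega> = (a * G \<omega> + b * (V \<omega> * Y \<omega>) + c * (Y \<omega>)\<^sup>2) * t"
    and [measurable]: "X \<in> borel_measurable M"
  shows "variance X = (a\<^sup>2 * (g2 - g1\<^sup>2) + b\<^sup>2 * (v2 * y2 - (v1 * y1)\<^sup>2) + c\<^sup>2 * (y4 - y2\<^sup>2)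
    + 2 * a * b * (gv * y1 - g1 * (v1 * y1)) + 2 * b * c * (v1 * y3 - v1 * y1 * y2)) * t\<^sup>2"
proof -
  note [measurable] = G(1)[unfolded has_bochner_integral_iff, THEN conjunct1]
    V(1)[unfolded has_bochner_integral_iff, THEN conjunct1] Y(1)[unfolded has_bochner_integral_iff, THEN conjunct1]
  let ?X = "\<lambda>\<omega>. (a * G \<omega> + b * (V \<omega> * Y \<omega>) + c * (Y \<omega>)\<^sup>2) * t"
  have 1: "has_bochner_integral M ?X ((a * g1 + b * (v1 * y1) + c * y2) * t)"
    by (intro has_bochner_integral_mult_left has_bochner_integral_add has_bochner_integral_mult_right
        has_bochner_integral_indep_mult G V Y ind)
  have "has_bochner_integral M (\<lambda>\<omega>. (a\<^sup>2 * (G \<omega>)\<^sup>2 + b\<^sup>2 * ((V \<omega>)\<^sup>2 * (Y \<omega>)\<^sup>2) + c\<^sup>2 * Y \<omega> ^ 4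
      + 2 * a * b * (G \<omega> * V \<omega> * Y \<omega>) + 2 * a * c * (G \<omega> * (Y \<omega>)\<^sup>2) + 2 * b * c * (V \<omega> * Y \<omega> ^ 3)) * t\<^sup>2)
      ((a\<^sup>2 * g2 + b\<^sup>2 * (v2 * y2) + c\<^sup>2 * y4 + 2 * a * b * (gv * y1) + 2 * a * c * (g1 * y2) + 2 * b * c * (v1 * y3)) * t\<^sup>2)"
    by (intro has_bochner_integral_mult_left has_bochner_integral_add has_bochner_integral_mult_right
        has_bochner_integral_indep_mult G V Y GV ind)
  also have "(\<lambda>\<omega>. (a\<^sup>2 * (G \<omega>)\<^sup>2 + b\<^sup>2 * ((V \<omega>)\<^sup>2 * (Y \<omega>)\<^sup>2) + c\<^sup>2 * Y \<omega> ^ 4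
      + 2 * a * b * (G \<omega> * V \<omega> * Y \<omega>) + 2 * a * c * (G \<omega> * (Y \<omega>)\<^sup>2) + 2 * b * c * (V \<omega> * Y \<omega> ^ 3)) * t\<^sup>2)
      = (\<lambda>\<omega>. (?X \<omega>)\<^sup>2)"
    by (rule ext) algebra
  finally have 2: "has_bochner_integral M (\<lambda>\<omega>. (?X \<omega>)\<^sup>2)
      ((a\<^sup>2 * g2 + b\<^sup>2 * (v2 * y2) + c\<^sup>2 * y4 + 2 * a * b * (gv * y1) + 2 * a * c * (g1 * y2) + 2 * b * c * (v1 * y3)) * t\<^sup>2)" .
  have e: "expectation X = expectation ?X"
    by (rule integral_cong_AE) (use X in auto)
  have "variance X = variance ?X"
    unfolding e by (rule integral_cong_AE) (use X in auto)
  also have "\<dots> = expectation (\<lambda>\<omega>. (?X \<omega>)\<^sup>2) - (expectation ?X)\<^sup>2"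
    by (rule variance_eq) (use 1 2 in \<open>auto simp: has_bochner_integral_iff\<close>)
  also have "\<dots> = (a\<^sup>2 * g2 + b\<^sup>2 * (v2 * y2) + c\<^sup>2 * y4 + 2 * a * b * (gv * y1) + 2 * a * c * (g1 * y2) + 2 * b * c * (v1 * y3)) * t\<^sup>2
      - ((a * g1 + b * (v1 * y1) + c * y2) * t)\<^sup>2"
    using 1 2 by (simp only: has_bochner_integral_iff)
  also have "\<dots> = (a\<^sup>2 * (g2 - g1\<^sup>2) + b\<^sup>2 * (v2 * y2 - (v1 * y1)\<^sup>2) + c\<^sup>2 * (y4 - y2\<^sup>2)
    + 2 * a * b * (gv * y1 - g1 * (v1 * y1)) + 2 * b * c * (v1 * y3 - v1 * y1 * y2)) * t\<^sup>2"
    by algebra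
  finally show ?thesis .
qed

theorem theorem2:
  fixes P :: "'a measure"
    and Rd :: "complex ^ 'm ^ 'm" and Rru :: "complex ^ 'n ^ 'n"
    and ud :: "'a \<Rightarrow> complex ^ 'm" and uru :: "'a \<Rightarrow> complex ^ 'n"
    and ab :: "complex ^ 'm" and ar :: "complex ^ 'n"
    and \<beta>d \<beta>br \<beta>ru \<tau> :: real
  defines "M \<equiv> real CARD('m)" and "N \<equiv> real CARD('n)"
  defines "h_d \<equiv> \<lambda>\<omega>. rayleigh_channel \<beta>d Rd (ud \<omega>)"
    and "h_ru \<equiv> \<lambda>\<omega>. rayleigh_channel \<beta>ru Rru (uru \<omega>)"
  defines "SNR \<equiv> \<lambda>\<omega>. opt_SNR \<tau> \<beta>br ab ar (h_d \<omega>) (h_ru \<omega>)"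
  defines "Y \<equiv> \<lambda>\<omega>. \<Sum>n\<in>UNIV. cmod ((mat_sqrt Rru *v uru \<omega>) $ n)"
  defines "A \<equiv> norm (mat_sqrt Rd *v ab)"
  defines "B \<equiv> M * A + Re (cdot ab ((Rd ** Rd) *v ab)) / (2 * A)"
  defines "C1 \<equiv> prob_space.expectation P (\<lambda>\<omega>. Y \<omega> ^ 3)"
    and "C2 \<equiv> prob_space.expectation P (\<lambda>\<omega>. Y \<omega> ^ 4)"
    and "F \<equiv> corr_F Rru"
  assumes "prob_space P"
    and "correlation_matrix Rd" and "correlation_matrix Rru"
    and "std_complex_normal_vec P ud" and "std_complex_normal_vec P uru"
    and "indep_rvs P ud uru"
    and "\<forall>i. cmod (ab $ i) = 1" and "\<forall>i. cmod (ar $ i) = 1"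
    and "mat_sqrt Rd *v ab \<noteq> 0"
    and "\<beta>d > 0" and "\<beta>br > 0" and "\<beta>ru > 0" and "\<tau> > 0"
  shows "prob_space.variance P SNR =
    (\<beta>d\<^sup>2 * Re (trace (Rd ** Rd))
     + \<beta>d powr (3/2) * sqrt (\<beta>br * \<beta>ru) * N * pi * (B - M * A)
     + \<beta>d * \<beta>br * \<beta>ru * A\<^sup>2 * (4 * (N + F) - N\<^sup>2 * pi\<^sup>2 / 4)
     + M * A * sqrt \<beta>d * (\<beta>br * \<beta>ru) powr (3/2) * (2 * sqrt pi * C1 - N * (N + F) * pi)
     + (M * \<beta>br * \<beta>ru)\<^sup>2 * (C2 - (N + F)\<^sup>2)) * \<tau>\<^sup>2"
proof -
  note Rd = \<open>correlation_matrix Rd\<close> and Rru = \<open>correlation_matrix Rru\<close>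
    and ud = \<open>std_complex_normal_vec P ud\<close> and uru = \<open>std_complex_normal_vec P uru\<close>
    and ab = \<open>\<forall>i. cmod (ab $ i) = 1\<close> and ar = \<open>\<forall>i. cmod (ar $ i) = 1\<close>
    and pP = \<open>prob_space P\<close> and ind = \<open>indep_rvs P ud uru\<close>
    and pos = \<open>\<beta>d > 0\<close> \<open>\<beta>br > 0\<close> \<open>\<beta>ru > 0\<close>
  interpret prob_space P by (rule pP)
  define S where "S = mat_sqrt Rd"
  define v where "v = S *v ab"
  \<comment> \<open>This is \<open>B - M * A\<close>: since Rd is Hermitian and equals S^2, the
    quadratic form of Rd^2 at \<open>ab\<close> is |Rd ab|^2 = |S v|^2.\<close>
  define k where "k = (norm (S *v v))\<^sup>2 / (2 * A)"
  have S: "hermitian S" "S ** S = Rd" and hRd: "hermitian Rd"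
    using row_facts[OF pP Rd ud] by (simp_all add: S_def)
  have v: "v \<noteq> 0" "norm v = A" using \<open>mat_sqrt Rd *v ab \<noteq> 0\<close> by (simp_all add: v_def S_def A_def)
  have A: "A > 0" using v by auto
  have B: "B = M * A + k"
  proof -
    have "cdot ab ((Rd ** Rd) *v ab) = cdot (Rd *v ab) (Rd *v ab)"
      by (simp add: cdot_hermitian[OF hRd] flip: matrix_vector_mul_assoc)
    moreover have "Rd *v ab = S *v v" by (simp add: v_def matrix_vector_mul_assoc S)
    ultimately show ?thesis by (simp add: B_def k_def cdot_norm_sq)
  qed
  define G where "G \<omega> = (norm (S *v ud \<omega>))\<^sup>2" for \<omega>
  define V where "V \<omega> = cmod (cdot v (ud \<omega>))" for \<omega>
  have G1: "has_bochner_integral P G M" and G2: "has_bochner_integral P (\<lambda>\<omega>. (G \<omega>)\<^sup>2) (M\<^sup>2 + Re (trace (Rd ** Rd)))"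
    using expectation_norm_sq[OF pP Rd ud] expectation_norm_sq_sq[OF pP Rd ud]
    by (simp_all add: G_def[abs_def] S_def M_def)
  have V1: "has_bochner_integral P V (A * sqrt pi / 2)"
    and GV: "has_bochner_integral P (\<lambda>\<omega>. G \<omega> * V \<omega>) (sqrt pi / 2 * (A * M + k))"
    using cmod_moments[OF pP Rd ud v(1)]
    by (simp_all add: V_def[abs_def] G_def S_def M_def k_def v(2))
  have V2: "has_bochner_integral P (\<lambda>\<omega>. (V \<omega>)\<^sup>2) (A\<^sup>2)"
    using cmod_sq[OF ud, of v] by (simp add: V_def v(2))
  have Y1: "has_bochner_integral P Y (N * sqrt pi / 2)" and Y2: "has_bochner_integral P (\<lambda>\<omega>. (Y \<omega>)\<^sup>2) (N + F)"
    and Y3: "has_bochner_integral P (\<lambda>\<omega>. Y \<omega> ^ 3) C1" and Y4: "has_bochner_integral P (\<lambda>\<omega>. Y \<omega> ^ 4) C2"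
    using amp_sum_first[OF pP Rru uru] amp_sum_second[OF pP Rru uru]
      amp_sum_third[OF pP Rru uru] amp_sum_fourth[OF pP Rru uru]
    by (simp_all add: Y_def[abs_def] N_def F_def C1_def C2_def has_bochner_integral_iff)
  have cont: "continuous_on UNIV (\<lambda>x. T *v x)" for T :: "complex ^ 'k ^ 'k"
    by (simp add: linear_continuous_on matrix_linear linear_conv_bounded_linear[THEN iffD1])
  have indep: "indep_var borel (\<lambda>\<omega>. f (ud \<omega>)) borel (\<lambda>\<omega>. g (uru \<omega>))"
    if "f \<in> borel_measurable borel" "g \<in> borel_measurable borel" for f :: "_ \<Rightarrow> real" and g :: "_ \<Rightarrow> real"
    using indep_rvs_compose[OF pP ind that] .
  have [measurable]: "(\<lambda>x. S *v x) \<in> borel_measurable borel" "(\<lambda>x. mat_sqrt Rru *v x) \<in> borel_measurable borel"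
    by (intro borel_measurable_continuous_onI cont)+
  have [measurable]: "(\<lambda>x. (mat_sqrt Rru *v x) $ n) \<in> borel_measurable borel" for n
    unfolding cdot_cnj_row[symmetric] by measurable
  have [measurable]: "ud \<in> borel_measurable P" "uru \<in> borel_measurable P"
    using ind by (auto simp: indep_rvs_def)
  \<comment> \<open>The coefficient of V Y. Its square gives the 4 in front of N + F, and 4 times (A
    N pi / 4)^2 gives the A^2 N^2 pi^2 / 4 subtracted there.\<close>
  define c2 where "c2 = 2 * (sqrt \<beta>d * sqrt (\<beta>br * \<beta>ru))"
  have snr: "SNR \<omega> = (\<beta>d * G \<omega> + c2 * (V \<omega> * Y \<omega>)
      + (if cdot v (ud \<omega>) = 0 then 0 else M * \<beta>br * \<beta>ru * (Y \<omega>)\<^sup>2)) * \<tau>" for \<omega>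
  proof -
    have hd: "h_d \<omega> = complex_of_real (sqrt \<beta>d) *s (S *v ud \<omega>)"
      by (simp add: h_d_def rayleigh_channel_def S_def scaleR_eq_vector_scalar_mult)
    have c: "cdot ab (h_d \<omega>) = sqrt \<beta>d * cdot v (ud \<omega>)"
      by (simp add: hd cdot_scale_right v_def cdot_hermitian[OF S(1)])
    have z: "(\<Sum>n\<in>UNIV. cmod (h_ru \<omega> $ n)) = sqrt \<beta>ru * Y \<omega>"
      using pos by (simp add: h_ru_def rayleigh_channel_def Y_def sum_distrib_left)
    have "SNR \<omega> = ((norm (h_d \<omega>))\<^sup>2 + 2 * sqrt \<beta>br * cmod (cdot ab (h_d \<omega>)) * (\<Sum>n\<in>UNIV. cmod (h_ru \<omega> $ n))
        + (if cdot ab (h_d \<omega>) = 0 then 0 else \<beta>br * real CARD('m) * (\<Sum>n\<in>UNIV. cmod (h_ru \<omega> $ n))\<^sup>2)) * \<tau>"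
      unfolding SNR_def by (rule opt_SNR_eq[OF ar ab]) (use pos in simp)
    also have "\<dots> = (\<beta>d * G \<omega> + 2 * sqrt \<beta>br * (sqrt \<beta>d * V \<omega>) * (sqrt \<beta>ru * Y \<omega>)
        + (if cdot v (ud \<omega>) = 0 then 0 else \<beta>br * M * (\<beta>ru * (Y \<omega>)\<^sup>2))) * \<tau>"
      unfolding z c using pos
      by (simp add: hd norm_vector_scalar_mult norm_mult power_mult_distrib G_def V_def M_def)
    also have "\<dots> = (\<beta>d * G \<omega> + c2 * (V \<omega> * Y \<omega>)
        + (if cdot v (ud \<omega>) = 0 then 0 else M * \<beta>br * \<beta>ru * (Y \<omega>)\<^sup>2)) * \<tau>"
      by (simp add: c2_def real_sqrt_mult algebra_simps)
    finally show ?thesis .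
  qed
  have [measurable]: "SNR \<in> borel_measurable P"
    unfolding snr[abs_def] G_def V_def Y_def by measurable
  have "variance SNR = (\<beta>d\<^sup>2 * (M\<^sup>2 + Re (trace (Rd ** Rd)) - M\<^sup>2)
      + c2\<^sup>2 * (A\<^sup>2 * (N + F) - (A * sqrt pi / 2 * (N * sqrt pi / 2))\<^sup>2)
      + (M * \<beta>br * \<beta>ru)\<^sup>2 * (C2 - (N + F)\<^sup>2)
      + 2 * \<beta>d * c2 * (sqrt pi / 2 * (A * M + k) * (N * sqrt pi / 2) - M * (A * sqrt pi / 2 * (N * sqrt pi / 2)))
      + 2 * c2 * (M * \<beta>br * \<beta>ru) * (A * sqrt pi / 2 * C1 - A * sqrt pi / 2 * (N * sqrt pi / 2) * (N + F))) * \<tau>\<^sup>2"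
  proof (rule variance_signal_plus_interaction[OF G1 G2 V1 V2 GV Y1 Y2 Y3 Y4])
    \<comment> \<open>The exceptional event is the vanishing of \<open>cdot v (ud \<omega>)\<close>,
      which is null because v is nonzero.\<close>
    show "AE \<omega> in P. SNR \<omega> = (\<beta>d * G \<omega> + c2 * (V \<omega> * Y \<omega>) + M * \<beta>br * \<beta>ru * (Y \<omega>)\<^sup>2) * \<tau>"
      using AE_cdot_nonzero[OF ud v(1)] by eventually_elim (simp add: snr)
  \<comment> \<open>Unfolding displays each pair as Borel functions of \<open>ud\<close> and of
    \<open>uru\<close>, the form that \<open>indep\<close> expects.\<close>
  qed (unfold G_def V_def Y_def, (rule indep; measurable)+, measurable)
  also have "\<dots> = (\<beta>d\<^sup>2 * Re (trace (Rd ** Rd))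
     + \<beta>d powr (3/2) * sqrt (\<beta>br * \<beta>ru) * N * pi * (B - M * A)
     + \<beta>d * \<beta>br * \<beta>ru * A\<^sup>2 * (4 * (N + F) - N\<^sup>2 * pi\<^sup>2 / 4)
     + M * A * sqrt \<beta>d * (\<beta>br * \<beta>ru) powr (3/2) * (2 * sqrt pi * C1 - N * (N + F) * pi)
     + (M * \<beta>br * \<beta>ru)\<^sup>2 * (C2 - (N + F)\<^sup>2)) * \<tau>\<^sup>2"
  proof -
    have c2: "c2\<^sup>2 = 4 * (\<beta>d * (\<beta>br * \<beta>ru))"
      using pos by (simp add: c2_def power_mult_distrib)
    have pw: "\<beta>d powr (3/2) = \<beta>d * sqrt \<beta>d" "(\<beta>br * \<beta>ru) powr (3/2) = \<beta>br * \<beta>ru * sqrt (\<beta>br * \<beta>ru)"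
      using pos by (simp_all add: powr_three_halves)
    have sp: "x * sqrt pi / 2 * (y * sqrt pi / 2) = x * y * pi / 4" "sqrt pi / 2 * x * (y * sqrt pi / 2) = x * y * pi / 4"
      for x y by simp_all
    show ?thesis
      \<comment> \<open>The square of \<open>c2\<close> is replaced before \<open>c2\<close> itself
        is unfolded, so it enters without square roots; the remaining linear occurrences supply the
        square roots in the two cross terms.\<close>
      unfolding pw B sp c2 unfolding c2_def by (simp add: field_simps power2_eq_square)
  qed
  finally show ?thesis .
qed

end
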